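(* Let $G=\langle h_1,\dots,h_m\rangle$ be a finitely generated polynomial semigroup in $\mathcal G$. For each $j=1,\dots,m$ let $a_j$ be the coefficient of the highest degree term of $h_j$ and let $\Psi(h_j):\mathbb R\to\mathbb R$ be the map $\Psi(h_j)(x)=\deg(h_j)\,x+\log|a_j|$. Let $$\alpha=\min_{j=1,\dots,m}\Big\{\frac{-1}{\deg(h_j)-1}\log|a_j|\Big\},\qquad \beta=\max_{j=1,\dots,m}\Big\{\frac{-1}{\deg(h_j)-1}\log|a_j|\Big\},$$ and $[\alpha,\beta]=\{x\in\mathbb R:\alpha\le x\le\beta\}$. If $[\alpha,\beta]\subset\bigcup_{j=1}^m\Psi(h_j)^{-1}([\alpha,\beta])$, then $J(G)$ is connected.
   Context: $\hat{\mathbb C}$ is the Riemann sphere. A polynomial semigroup is a semigroup (under composition) generated by a family of non-constant polynomial maps on $\hat{\mathbb C}$; $\langle h_1,\dots,h_m\rangle$ is the semigroup generated by $h_1,\dots,h_m$. The Fatou set $F(G)$ is the set of $z\in\hat{\mathbb C}$ having a neighborhood on which $G$ is a normal family; the Julia set is $J(G)=\hat{\mathbb C}\setminus F(G)$. $P(G)=\overline{\bigcup_{g\in G}\{\text{critical values of } g:\hat{\mathbb C}\to\hat{\mathbb C}\}}$ and $P^{*}(G)=P(G)\setminus\{\infty\}$. $\mathcal G$ is the set of polynomial semigroups $G$ all of whose elements have degree at least two and for which $P^{*}(G)$ is bounded in $\mathbb C$. *)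

theory Defs
  imports
    "HOL-Analysis.Analysis"
    "HOL-Computational_Algebra.Polynomial"
begin

text \<open>
  The Riemann sphere is the one-point compactification of the complex plane; its points are
  \<^term>\<open>Some z\<close> for complex \<open>z\<close>, and \<^term>\<open>None\<close> for infinity.
\<close>

definition riemann_sphere :: "complex option topology" where
  "riemann_sphere = Alexandroff_compactification euclidean"

text \<open>
  The inverse stereographic projection onto the unit sphere of \<open>\<complex> \<times> \<real>\<close>. The distance of two
  image points is the chordal distance on the Riemann sphere, with respect to which uniform
  convergence in the definition of normality is understood.
\<close>

definition stereo :: "complex option \<Rightarrow> complex \<times> real" where
  "stereo x = (case x of
      None \<Rightarrow> (0, 1)
    | Some z \<Rightarrow> ((2 / ((cmod z)\<^sup>2 + 1)) *\<^sub>R z, ((cmod z)\<^sup>2 - 1) / ((cmod z)\<^sup>2 + 1)))"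

lemma stereo_image: "range stereo = sphere 0 1"
proof (intro equalityI subsetI)
  fix p assume "p \<in> range stereo"
  then obtain x where p: "p = stereo x" by auto
  show "p \<in> sphere 0 1"
  proof (cases x)
    case None
    then show ?thesis by (simp add: p stereo_def norm_Pair)
  next
    case (Some z)
    define s where "s = (cmod z)\<^sup>2"
    have s: "s \<ge> 0" by (simp add: s_def)
    have "(norm p)\<^sup>2 = (2 / (s + 1))\<^sup>2 * s + ((s - 1) / (s + 1))\<^sup>2"
      by (simp add: p Some stereo_def norm_Pair s_def power_mult_distrib power_divide)
    also have "\<dots> = ((2\<^sup>2 * s + (s - 1)\<^sup>2) / (s + 1)\<^sup>2)"
      by (simp add: power_divide add_divide_distrib)
    also have "2\<^sup>2 * s + (s - 1)\<^sup>2 = (s + 1)\<^sup>2"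
      by (simp add: power2_eq_square algebra_simps)
    also have "(s + 1)\<^sup>2 / (s + 1)\<^sup>2 = 1"
      using s by simp
    finally show ?thesis
      using power2_eq_1_iff[of "norm p"] norm_ge_zero[of p] by (auto simp: dist_norm)
  qed
next
  fix p :: "complex \<times> real" assume "p \<in> sphere 0 1"
  obtain w t where wt: "p = (w, t)" by (cases p)
  have n: "(cmod w)\<^sup>2 + t\<^sup>2 = 1"
    using \<open>p \<in> sphere 0 1\<close> by (simp add: wt norm_Pair)
  show "p \<in> range stereo"
  proof (cases "t = 1")
    case True
    then have "p = stereo None" using n by (simp add: wt stereo_def)
    then show ?thesis by blast
  next
    case False
    have "t\<^sup>2 \<le> 1" using n zero_le_power2[of "cmod w"] by linarith
    with False have t: "t < 1" by (simp add: abs_square_le_1)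
    define z where "z = (1 / (1 - t)) *\<^sub>R w"
    have z: "(cmod z)\<^sup>2 = (1 + t) / (1 - t)"
    proof -
      have "(cmod z)\<^sup>2 = (cmod w)\<^sup>2 / (1 - t)\<^sup>2"
        by (simp add: z_def power_divide)
      also have "(cmod w)\<^sup>2 = (1 + t) * (1 - t)"
        using n by (simp add: power2_eq_square algebra_simps)
      finally show ?thesis using t by (simp add: power2_eq_square)
    qed
    have "(cmod z)\<^sup>2 + 1 = 2 / (1 - t)" "(cmod z)\<^sup>2 - 1 = 2 * t / (1 - t)"
      unfolding z using t by (simp_all add: field_simps)
    then have "p = stereo (Some z)"
      using t by (simp add: stereo_def wt) (simp add: z_def)
    then show ?thesis by blast
  qed
qed

lemma stereo_inj: "inj stereo"
proof (rule injI)
  fix x y assume eq: "stereo x = stereo y"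
  have key: "((cmod z)\<^sup>2 - 1) / ((cmod z)\<^sup>2 + 1) = 1 - 2 / ((cmod z)\<^sup>2 + 1)" for z
  proof -
    have "(cmod z)\<^sup>2 + 1 \<noteq> 0" using zero_le_power2[of "cmod z"] by linarith
    then show ?thesis by (simp add: field_simps)
  qed
  have pos: "(cmod z)\<^sup>2 + 1 > 0" for z
    using zero_le_power2[of "cmod z"] by linarith
  show "x = y"
  proof (cases x; cases y)
    fix z w assume xy: "x = Some z" "y = Some w"
    have h: "2 / ((cmod z)\<^sup>2 + 1) = 2 / ((cmod w)\<^sup>2 + 1)"
      and e: "(2 / ((cmod z)\<^sup>2 + 1)) *\<^sub>R z = (2 / ((cmod w)\<^sup>2 + 1)) *\<^sub>R w"
      using eq unfolding stereo_def xy option.case key prod.inject by (linarith, blast)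
    have "2 / ((cmod w)\<^sup>2 + 1) \<noteq> 0" using pos[of w] by simp
    with e[unfolded h] have "z = w" by (simp only: scaleR_cancel_left) simp
    then show "x = y" by (simp add: xy)
  next
    fix z assume "x = Some z" "y = None"
    then show "x = y" using eq pos[of z] by (simp add: stereo_def key)
  next
    fix z assume "x = None" "y = Some z"
    then show "x = y" using eq pos[of z] by (simp add: stereo_def key)
  qed simp
qed

lemma stereo_homeomorphic:
  "homeomorphic_map riemann_sphere (top_of_set (sphere 0 1)) stereo"
proof (rule continuous_imp_homeomorphic_map)
  have [simp]: "topspace riemann_sphere = UNIV"
    by (simp add: riemann_sphere_def UNIV_option_conv)
  have pos: "(cmod z)\<^sup>2 + 1 \<noteq> 0" for z
    using zero_le_power2[of "cmod z"] by linarith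
  have cont: "continuous_on UNIV (\<lambda>z. stereo (Some z))"
    unfolding stereo_def option.case by (intro continuous_intros) (simp_all add: pos)
  have lim: "((\<lambda>z. stereo (Some z)) \<longlongrightarrow> stereo None) at_infinity"
  proof -
    have n: "LIM z at_infinity. cmod z :> at_top"
      by (rule filterlim_norm_at_top)
    have a: "LIM z at_infinity. (cmod z)\<^sup>2 + 1 :> at_top"
      by (intro filterlim_at_top_add_at_top filterlim_pow_at_top n
          filterlim_tendsto_add_at_top[OF tendsto_const]
          filterlim_at_top_mono[OF filterlim_pow_at_top[OF _ n, of 2]]) auto
    have i: "((\<lambda>z. 2 / ((cmod z)\<^sup>2 + 1)) \<longlongrightarrow> 0) at_infinity"
      by (rule tendsto_divide_0[OF tendsto_const])
         (rule filterlim_at_top_imp_at_infinity[OF a])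
    have eq: "((cmod z)\<^sup>2 - 1) / ((cmod z)\<^sup>2 + 1) = 1 - 2 / ((cmod z)\<^sup>2 + 1)" for z
      using pos[of z] by (simp add: field_simps)
    have "((\<lambda>z. ((cmod z)\<^sup>2 - 1) / ((cmod z)\<^sup>2 + 1)) \<longlongrightarrow> 1 - 0) at_infinity"
      unfolding eq by (intro tendsto_intros i)
    moreover have "((\<lambda>z. (2 / ((cmod z)\<^sup>2 + 1)) *\<^sub>R z) \<longlongrightarrow> 0) at_infinity"
    proof (rule Lim_null_comparison)
      show "((\<lambda>z. 2 / cmod z) \<longlongrightarrow> 0) at_infinity"
        by (rule tendsto_divide_0[OF tendsto_const])
           (rule filterlim_at_top_imp_at_infinity[OF n])
      have "norm ((2 / ((cmod z)\<^sup>2 + 1)) *\<^sub>R z) \<le> 2 / cmod z" for z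
      proof (cases "z = 0")
        case False
        then have "2 * cmod z / ((cmod z)\<^sup>2 + 1) \<le> 2 * cmod z / (cmod z)\<^sup>2"
          by (intro divide_left_mono mult_pos_pos) (auto intro: add_pos_pos)
        with False show ?thesis by (simp add: power2_eq_square)
      qed simp
      then show "\<forall>\<^sub>F z in at_infinity. norm ((2 / ((cmod z)\<^sup>2 + 1)) *\<^sub>R z) \<le> 2 / cmod z"
        by simp
    qed
    ultimately show ?thesis
      unfolding stereo_def option.case by (intro tendsto_Pair) simp_all
  qed
  have "openin riemann_sphere {x. stereo x \<in> W}" if W: "open W" for W
  proof (cases "stereo None \<in> W")
    case False
    then have "{x. stereo x \<in> W} = Some ` {z. stereo (Some z) \<in> W}"
      by (auto simp: image_iff) (metis option.exhaust)
    moreover have "open {z. stereo (Some z) \<in> W}"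
      using open_vimage[OF W cont] by (simp add: vimage_def)
    ultimately show ?thesis
      unfolding riemann_sphere_def openin_Alexandroff_compactification by auto
  next
    case True
    define C where "C = - {z. stereo (Some z) \<in> W}"
    have "closed C"
      using open_vimage[OF W cont] by (simp add: vimage_def C_def closed_Compl)
    moreover have "bounded C"
    proof -
      have "\<forall>\<^sub>F z in at_infinity. stereo (Some z) \<in> W"
        using lim W True by (simp add: tendsto_def)
      then obtain b where "\<And>z. b \<le> cmod z \<Longrightarrow> stereo (Some z) \<in> W"
        by (auto simp: eventually_at_infinity)
      then have "\<forall>z\<in>C. cmod z \<le> b" by (metis (mono_tags, lifting) ComplD C_def CollectI linear)
      then show ?thesis by (auto simp: bounded_iff)
    qed
    moreover have "{x. stereo x \<in> W} = insert None (Some ` (UNIV - C))"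
      using True by (auto simp: C_def image_iff) (metis option.exhaust)
    ultimately show ?thesis
      unfolding riemann_sphere_def openin_Alexandroff_compactification
      by (intro disjI2 exI[of _ C]) (simp add: compact_eq_bounded_closed)
  qed
  then have "continuous_map riemann_sphere euclidean stereo"
    by (simp add: continuous_map_def)
  then show "continuous_map riemann_sphere (top_of_set (sphere 0 1)) stereo"
    using stereo_image by (auto simp: continuous_map_in_subtopology)
  show "compact_space riemann_sphere"
    by (simp add: riemann_sphere_def compact_space_Alexandroff_compactification)
  show "Hausdorff_space (top_of_set (sphere (0 :: complex \<times> real) 1))"
    by (simp add: Hausdorff_space_subtopology)
  show "stereo ` topspace riemann_sphere = topspace (top_of_set (sphere 0 1))"
    using stereo_image by simp
  show "inj_on stereo (topspace riemann_sphere)"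
    using stereo_inj inj_on_subset by blast
qed

text \<open>
  A family of self-maps of the sphere is normal on \<open>U\<close> if every sequence in the family has a
  subsequence that converges uniformly on compact subsets of \<open>U\<close> in the chordal distance;
  the limit may take the value infinity.
\<close>

definition normal_family_on ::
    "complex option set \<Rightarrow> (complex option \<Rightarrow> complex option) set \<Rightarrow> bool" where
  "normal_family_on U F \<longleftrightarrow>
     (\<forall>f :: nat \<Rightarrow> complex option \<Rightarrow> complex option. range f \<subseteq> F \<longrightarrow>
        (\<exists>r :: nat \<Rightarrow> nat. strict_mono r \<and>
          (\<exists>l :: complex option \<Rightarrow> complex option. \<forall>K. compactin riemann_sphere K \<and> K \<subseteq> U \<longrightarrow>
             uniform_limit K (\<lambda>n. stereo \<circ> f (r n)) (stereo \<circ> l) sequentially)))"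

definition fatou_set :: "(complex option \<Rightarrow> complex option) set \<Rightarrow> complex option set" where
  "fatou_set G = {z. \<exists>U. openin riemann_sphere U \<and> z \<in> U \<and> normal_family_on U G}"

definition julia_set :: "(complex option \<Rightarrow> complex option) set \<Rightarrow> complex option set" where
  "julia_set G = UNIV - fatou_set G"

text \<open>
  Holomorphic charts of the sphere: \<open>sphere_coord x\<close> is a local coordinate near the point \<open>x\<close>
  and \<open>sphere_param x\<close> is its local inverse. The coordinate at infinity is \<open>1/z\<close>; the values at
  points outside the chart domain are irrelevant. Critical points are the points where the
  derivative in such charts vanishes, so infinity is treated on the same footing as the others.
\<close>

definition sphere_coord :: "complex option \<Rightarrow> complex option \<Rightarrow> complex" where
  "sphere_coord x y = (case x of
      Some _ \<Rightarrow> (case y of Some z \<Rightarrow> z | None \<Rightarrow> 0)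
    | None \<Rightarrow> (case y of Some z \<Rightarrow> inverse z | None \<Rightarrow> 0))"

definition sphere_param :: "complex option \<Rightarrow> complex \<Rightarrow> complex option" where
  "sphere_param x w = (case x of
      Some _ \<Rightarrow> Some w
    | None \<Rightarrow> (if w = 0 then None else Some (inverse w)))"

definition critical_point :: "(complex option \<Rightarrow> complex option) \<Rightarrow> complex option \<Rightarrow> bool" where
  "critical_point g x \<longleftrightarrow>
     ((\<lambda>w. sphere_coord (g x) (g (sphere_param x w))) has_field_derivative 0)
       (at (sphere_coord x x))"

definition critical_values :: "(complex option \<Rightarrow> complex option) \<Rightarrow> complex option set" where
  "critical_values g = {g x | x. critical_point g x}"

definition postcritical_set :: "(complex option \<Rightarrow> complex option) set \<Rightarrow> complex option set" where
  "postcritical_set G = riemann_sphere closure_of (\<Union>g\<in>G. critical_values g)"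

definition planar_postcritical_set :: "(complex option \<Rightarrow> complex option) set \<Rightarrow> complex set" where
  "planar_postcritical_set G = {z. Some z \<in> postcritical_set G}"

text \<open>
  The extension of a polynomial to the sphere. It fixes infinity, so this is the intended map
  for non-constant polynomials only.
\<close>

definition sphere_poly :: "complex poly \<Rightarrow> complex option \<Rightarrow> complex option" where
  "sphere_poly p = map_option (poly p)"

lemma critical_point_sphere_poly:
  "critical_point (sphere_poly p) (Some z) \<longleftrightarrow> poly (pderiv p) z = 0"
proof -
  have "critical_point (sphere_poly p) (Some z) \<longleftrightarrow> (poly p has_field_derivative 0) (at z)"
    by (simp add: critical_point_def sphere_poly_def sphere_coord_def sphere_param_def)
  then show ?thesis
    using poly_DERIV[of p z] DERIV_unique by metis
qed

inductive_set generated_semigroup :: "('a \<Rightarrow> 'a) set \<Rightarrow> ('a \<Rightarrow> 'a) set"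
  for H :: "('a \<Rightarrow> 'a) set" where
  generator: "h \<in> H \<Longrightarrow> h \<in> generated_semigroup H"
| compose: "f \<in> generated_semigroup H \<Longrightarrow> g \<in> generated_semigroup H \<Longrightarrow>
    f \<circ> g \<in> generated_semigroup H"

definition polynomial_semigroup :: "(complex option \<Rightarrow> complex option) set \<Rightarrow> bool" where
  "polynomial_semigroup G \<longleftrightarrow>
     (\<exists>P. P \<noteq> {} \<and> (\<forall>p\<in>P. degree p \<ge> 1) \<and> G = generated_semigroup (sphere_poly ` P))"

definition postcritically_bounded_semigroups ::
    "(complex option \<Rightarrow> complex option) set set" where
  "postcritically_bounded_semigroups = {G. polynomial_semigroup G \<and>
     (\<forall>g\<in>G. \<exists>p. degree p \<ge> 2 \<and> g = sphere_poly p) \<and>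
     bounded (planar_postcritical_set G)}"

definition Psi :: "complex poly \<Rightarrow> real \<Rightarrow> real" where
  "Psi p x = real (degree p) * x + ln (cmod (lead_coeff p))"

end

theory Submission
  imports Defs "HOL-Complex_Analysis.Complex_Analysis"
    "HOL-Computational_Algebra.Fundamental_Theorem_Algebra"
begin

text \<open>
  For an infinite word \<open>\<omega>\<close> in the generators let \<open>K \<omega>\<close> be the set of points with bounded orbit
  along \<open>\<omega>\<close>. Since the postcritical set is bounded, \<open>K \<omega>\<close> is a decreasing intersection of
  connected lemniscates, so \<open>K \<omega>\<close>, its complement and its boundary \<open>J \<omega>\<close> are connected; the
  Julia set lies between the union of all \<open>J \<omega>\<close> and its closure, by the theorems of Schottky
  and Montel. The logarithmic capacity of \<open>K \<omega>\<close> is the point coded by \<open>\<omega>\<close> in the real affine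
  system of the inverses of the maps \<open>Psi (h j)\<close>, and the hypothesis says that these points
  fill \<open>[\<alpha>, \<beta>]\<close>. All \<open>K \<omega>\<close> share a point, so if \<open>J \<omega>\<close> and \<open>J \<tau>\<close> are disjoint then one of
  \<open>K \<omega>\<close>, \<open>K \<tau>\<close> lies in the interior of the other and the capacities differ. A separation of the
  union of the \<open>J \<omega>\<close> would therefore separate the interval \<open>[\<alpha>, \<beta>]\<close>.
\<close>

section \<open>Polynomial lemniscates\<close>

text \<open>Why \<open>Psi\<close>: pulling a compact set back under a polynomial of degree d with
  leading coefficient a turns the log capacity x into (x - log |a|)/d, which is the inverse of
  \<open>Psi\<close>. Capacity itself is never defined. Since {|p| \<le> t} has capacity
  (t/|a|)^(1/d), inequalities between leading coefficients do its work. The delicate point is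
  strictness, and it comes from the factor 2 in the escape condition: if K \<omega> lies in the
  interior of K \<tau>, then some lemniscate of \<omega> at level 2R still lies in K \<tau>, and the
  gap log 2 is multiplied by degrees that grow along \<tau> while the coding errors stay bounded.
  The second obstacle is that the code space is totally disconnected and a number may have several
  codes. A separation is therefore pushed forward to [\<alpha>, \<beta>], where compactness of the
  code space and lower semicontinuity of J make both parts closed. The shared point is a critical
  value of one generator: its images under words are again critical values.\<close>

lemma cmod_diff_le_cmod_scaleR_diff:
  fixes x z :: complex
  assumes "cmod x \<le> cmod z" and "1 \<le> s"
  shows "cmod (z - x) \<le> cmod (s *\<^sub>R z - x)"
proof -
  have "(s *\<^sub>R z - x) \<bullet> (s *\<^sub>R z - x) - (z - x) \<bullet> (z - x) = (s - 1) * ((s + 1) * (z \<bullet> z) - 2 * (z \<bullet> x))"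
    by (simp add: inner_diff_left inner_diff_right inner_commute algebra_simps)
  moreover have "z \<bullet> x \<le> z \<bullet> z"
  proof -
    have "z \<bullet> x \<le> cmod z * cmod x"
      by (rule norm_cauchy_schwarz)
    also have "\<dots> \<le> cmod z * cmod z"
      using assms by (intro mult_left_mono) auto
    finally show ?thesis
      by (simp add: norm_eq_sqrt_inner)
  qed
  moreover have "2 * (z \<bullet> z) \<le> (s + 1) * (z \<bullet> z)"
    using assms by (intro mult_right_mono) auto
  ultimately have "(z - x) \<bullet> (z - x) \<le> (s *\<^sub>R z - x) \<bullet> (s *\<^sub>R z - x)"
    using assms(2) mult_nonneg_nonneg[of "s - 1" "(s + 1) * (z \<bullet> z) - 2 * (z \<bullet> x)"] by linarith
  then show ?thesis
    by (simp add: norm_eq_sqrt_inner)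
qed

text \<open>Each linear factor grows along rays from 0 once |z| has passed the modulus of its root,
  so the product grows beyond all roots.\<close>

lemma cmod_poly_le_scaleR:
  assumes "p \<noteq> 0"
  shows "\<exists>\<rho>. \<forall>z s. \<rho> \<le> cmod z \<longrightarrow> 1 \<le> s \<longrightarrow> cmod (poly p z) \<le> cmod (poly p (s *\<^sub>R z))"
proof -
  obtain A where A: "p = smult (lead_coeff p) (\<Prod>x\<in>#A. [:-x, 1:])"
    using alg_closed_imp_factorization[OF assms] by blast
  have "\<exists>\<rho>. \<forall>z s. \<rho> \<le> cmod z \<longrightarrow> 1 \<le> s \<longrightarrow>
      cmod (poly (\<Prod>x\<in>#A. [:-x, 1:]) z) \<le> cmod (poly (\<Prod>x\<in>#A. [:-x, 1:]) (s *\<^sub>R z))"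
  proof (induction A)
    case empty
    then show ?case by simp
  next
    case (add x A)
    then obtain \<rho> where \<rho>: "\<forall>z s. \<rho> \<le> cmod z \<longrightarrow> 1 \<le> s \<longrightarrow>
      cmod (poly (\<Prod>x\<in>#A. [:-x, 1:]) z) \<le> cmod (poly (\<Prod>x\<in>#A. [:-x, 1:]) (s *\<^sub>R z))"
      by blast
    have "cmod (poly (\<Prod>x\<in>#add_mset x A. [:-x, 1:]) z)
        \<le> cmod (poly (\<Prod>x\<in>#add_mset x A. [:-x, 1:]) (s *\<^sub>R z))"
      if "max \<rho> (cmod x) \<le> cmod z" "1 \<le> s" for z s
    proof -
      have "cmod (z - x) * cmod (poly (\<Prod>x\<in>#A. [:-x, 1:]) z)
         \<le> cmod (s *\<^sub>R z - x) * cmod (poly (\<Prod>x\<in>#A. [:-x, 1:]) (s *\<^sub>R z))"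
        using \<rho> that by (intro mult_mono cmod_diff_le_cmod_scaleR_diff) auto
      moreover have "poly (\<Prod>x\<in>#add_mset x A. [:-x, 1:]) w = (w - x) * poly (\<Prod>x\<in>#A. [:-x, 1:]) w" for w
        by (simp add: algebra_simps)
      ultimately show ?thesis
        by (simp only: norm_mult)
    qed
    then show ?case by blast
  qed
  then obtain \<rho> where \<rho>: "\<forall>z s. \<rho> \<le> cmod z \<longrightarrow> 1 \<le> s \<longrightarrow>
      cmod (poly (\<Prod>x\<in>#A. [:-x, 1:]) z) \<le> cmod (poly (\<Prod>x\<in>#A. [:-x, 1:]) (s *\<^sub>R z))"
    by blast
  have "cmod (poly p z) \<le> cmod (poly p (s *\<^sub>R z))" if "\<rho> \<le> cmod z" "1 \<le> s" for z s
    using \<rho>[rule_format, OF that] by (subst (1 2) A) (simp add: norm_mult mult_left_mono)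
  then show ?thesis by blast
qed

section \<open>Topology of sublevel and superlevel sets\<close>

lemma bounded_poly_sublevel:
  fixes p :: "complex poly"
  assumes "degree p \<ge> 1"
  shows "bounded {z. cmod (poly p z) \<le> t}"
proof -
  obtain a q where p: "p = pCons a q"
    by (cases p)
  with assms have "q \<noteq> 0"
    by auto
  then obtain r where r: "\<forall>z. r \<le> cmod z \<longrightarrow> t + 1 \<le> cmod (poly p z)"
    using poly_infinity[of q "t + 1" a] p by auto
  have "cmod z \<le> r" if "cmod (poly p z) \<le> t" for z
    using r[rule_format, of z] that by (cases "r \<le> cmod z") auto
  then show ?thesis
    by (auto simp: bounded_iff)
qed

lemma closed_poly_sublevel: "closed {z :: complex. cmod (poly p z) \<le> t}"
  by (intro closed_Collect_le continuous_intros)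

lemma open_poly_sublevel: "open {z :: complex. cmod (poly p z) < t}"
  by (intro open_Collect_less continuous_intros)

lemma open_poly_superlevel: "open {z :: complex. cmod (poly p z) > t}"
  by (intro open_Collect_less continuous_intros)

lemma compact_poly_sublevel:
  fixes p :: "complex poly"
  assumes "degree p \<ge> 1"
  shows "compact {z. cmod (poly p z) \<le> t}"
  using bounded_poly_sublevel[OF assms] closed_poly_sublevel by (simp add: compact_eq_bounded_closed)

lemma poly_not_constant_on_ball:
  fixes p :: "complex poly"
  assumes "degree p \<ge> 1" "r > 0"
  shows "\<not> poly p constant_on ball z r"
proof
  assume "poly p constant_on ball z r"
  then obtain c where c: "\<And>w. w \<in> ball z r \<Longrightarrow> poly p w = c"
    by (auto simp: constant_on_def)
  have "p - [:c:] \<noteq> 0"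
    using assms(1) by auto
  then have "finite {w. poly (p - [:c:]) w = 0}"
    by (rule poly_roots_finite)
  moreover have "ball z r \<subseteq> {w. poly (p - [:c:]) w = 0}"
    using c by auto
  ultimately have "finite (ball z r)"
    by (rule rev_finite_subset)
  then show False
    using assms(2) uncountable_ball countable_finite by blast
qed

text \<open>By the open mapping theorem, every neighbourhood of a point z of the level curve has a
  point whose image is p(z) moved slightly towards 0.\<close>

lemma closure_poly_sublevel:
  fixes p :: "complex poly"
  assumes "degree p \<ge> 1" "t > 0"
  shows "closure {z. cmod (poly p z) < t} = {z. cmod (poly p z) \<le> t}"
proof
  show "closure {z. cmod (poly p z) < t} \<subseteq> {z. cmod (poly p z) \<le> t}"
    by (rule closure_minimal[OF _ closed_poly_sublevel]) auto
  show "{z. cmod (poly p z) \<le> t} \<subseteq> closure {z. cmod (poly p z) < t}"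
  proof
    fix z assume z: "z \<in> {z. cmod (poly p z) \<le> t}"
    have "\<exists>y\<in>{z. cmod (poly p z) < t}. dist y z < e" if e: "e > 0" for e
    proof -
      have "open (poly p ` ball z e)"
        using poly_not_constant_on_ball[OF assms(1) e]
        by (intro open_mapping_thm[of _ "ball z e"]) (auto intro: holomorphic_intros)
      then obtain d where d: "d > 0" "ball (poly p z) d \<subseteq> poly p ` ball z e"
        using e by (force elim!: openE)
      \<comment> \<open>The second bound keeps \<open>(1 - u) *\<^sub>R poly p z\<close> within d of
        \<open>poly p z\<close>; the summand 1 avoids division by zero when p vanishes at z.\<close>
      define u where "u = min (1/2) (d / (2 * (cmod (poly p z) + 1)))"
      have u: "0 < u" "u < 1"
        using d(1) by (auto simp: u_def add_nonneg_pos min_less_iff_disj)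
      have "u * cmod (poly p z) < d"
      proof -
        have "u * cmod (poly p z) \<le> d / (2 * (cmod (poly p z) + 1)) * cmod (poly p z)"
          by (intro mult_right_mono) (auto simp: u_def)
        also have "\<dots> < d"
        proof -
          have "d * cmod (poly p z) < d * (2 * (cmod (poly p z) + 1))"
            using d(1) by (intro mult_strict_left_mono) (auto intro: add_nonneg_pos simp: algebra_simps add_strict_increasing)
          then show ?thesis
            using add_nonneg_pos[of "2 * cmod (poly p z)" 2] by (simp add: divide_less_eq algebra_simps)
        qed
        finally show ?thesis .
      qed
      then have "(1 - u) *\<^sub>R poly p z \<in> ball (poly p z) d"
        using u by (simp add: dist_norm algebra_simps norm_mult)
      then obtain y where y: "y \<in> ball z e" "poly p y = (1 - u) *\<^sub>R poly p z"
        using d(2) by (metis image_iff subsetD)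
      have "cmod (poly p y) < t"
      proof (cases "poly p z = 0")
        case True
        then show ?thesis using assms(2) y by simp
      next
        case False
        then have "(1 - u) * cmod (poly p z) < 1 * cmod (poly p z)"
          using u by (intro mult_strict_right_mono) auto
        moreover have "cmod (poly p y) = (1 - u) * cmod (poly p z)"
          using y u by simp
        ultimately show ?thesis using z by simp
      qed
      then show ?thesis
        using y(1) by (auto simp: dist_commute)
    qed
    then show "z \<in> closure {z. cmod (poly p z) < t}"
      by (simp add: closure_approachable)
  qed
qed

text \<open>Large sublevel sets are star-shaped about 0: moving towards 0, |p| does not increase
  outside the disc of radius \<rho>, and in that disc it is bounded by T < t.\<close>

lemma large_sublevel_connected:
  fixes p :: "complex poly"
  assumes "degree p \<ge> 1"
  shows "\<exists>T. \<forall>t\<ge>T. connected {z. cmod (poly p z) < t}"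
proof -
  have "p \<noteq> 0"
    using assms by auto
  then obtain \<rho> where \<rho>: "\<And>z s. \<rho> \<le> cmod z \<Longrightarrow> 1 \<le> s \<Longrightarrow> cmod (poly p z) \<le> cmod (poly p (s *\<^sub>R z))"
    using cmod_poly_le_scaleR by blast
  have "bounded (poly p ` cball 0 \<rho>)"
    by (intro compact_imp_bounded compact_continuous_image continuous_intros compact_cball)
  then obtain T where T: "\<And>z. cmod z \<le> \<rho> \<Longrightarrow> cmod (poly p z) \<le> T"
    by (force simp: bounded_iff)
  have "connected {z. cmod (poly p z) < t}" if t: "t \<ge> max T (cmod (poly p 0)) + 1" for t
  proof (rule starlike_imp_connected)
    have "u *\<^sub>R z \<in> {z. cmod (poly p z) < t}"
      if z: "cmod (poly p z) < t" and u: "0 \<le> u" "u \<le> 1" for z u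
    proof (cases "cmod (u *\<^sub>R z) \<le> \<rho>")
      case True
      then show ?thesis using T[OF True] t by auto
    next
      case False
      show ?thesis
      proof (cases "u = 0")
        case True
        then show ?thesis using t by auto
      next
        case nz: False
        have "cmod (poly p (u *\<^sub>R z)) \<le> cmod (poly p (inverse u *\<^sub>R (u *\<^sub>R z)))"
          using False u nz by (intro \<rho>) (auto simp: one_le_inverse_iff)
        with z nz show ?thesis by simp
      qed
    qed
    then show "starlike {z. cmod (poly p z) < t}"
      using t unfolding starlike_def closed_segment_def by (intro bexI[of _ 0]) auto
  qed
  then show ?thesis by blast
qed

text \<open>Minimum principle: without a root in C, the function 1/p is holomorphic there and has
  modulus 1/t on the frontier, yet exceeds 1/t inside.\<close>

lemma component_sublevel_contains_root:
  fixes p :: "complex poly"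
  assumes "degree p \<ge> 1" and C: "C \<in> components {z. cmod (poly p z) < t}"
  shows "\<exists>z\<in>C. poly p z = 0"
proof (rule ccontr)
  assume nz: "\<not> ?thesis"
  let ?U = "{z. cmod (poly p z) < t}"
  have sub: "C \<subseteq> ?U" and ne: "C \<noteq> {}" and op: "open C"
    using C in_components_subset in_components_nonempty open_components[OF open_poly_sublevel] by blast+
  then obtain z where z: "z \<in> C" "cmod (poly p z) < t"
    by blast
  then have t: "t > 0"
    using norm_ge_zero[of "poly p z"] by linarith
  have fr: "cmod (poly p w) = t" if "w \<in> frontier C" for w
  proof -
    have "w \<in> frontier ?U"
      using frontier_of_components_subset[OF C] that by blast
    then show ?thesis
      by (simp add: frontier_def closure_poly_sublevel[OF assms(1) t] interior_open[OF open_poly_sublevel])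
  qed
  have nz': "poly p w \<noteq> 0" if "w \<in> closure C" for w
    using that nz fr t closure_Un_frontier[of C] by fastforce
  have "cmod (inverse (poly p z)) \<le> inverse t"
  proof (rule maximum_modulus_frontier[where f = "\<lambda>w. inverse (poly p w)" and S = C])
    show "(\<lambda>z. inverse (poly p z)) holomorphic_on interior C"
      using nz' interior_subset closure_subset by (intro holomorphic_intros) blast
    show "continuous_on (closure C) (\<lambda>z. inverse (poly p z))"
      using nz' by (intro continuous_intros) auto
    show "bounded C"
      using sub by (intro bounded_subset[OF bounded_poly_sublevel[OF assms(1), of t]]) auto
    show "\<And>z. z \<in> frontier C \<Longrightarrow> cmod (inverse (poly p z)) \<le> inverse t"
      using fr by (simp add: norm_inverse)
  qed (fact z(1))
  moreover have "inverse t < inverse (cmod (poly p z))"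
    using z nz' closure_subset by (intro less_imp_inverse_less) auto
  ultimately show False
    by (simp add: norm_inverse)
qed

text \<open>The complement is bounded, so a disconnected superlevel set would have a bounded
  component. On its frontier |p| \<le> t, against the maximum principle.\<close>

lemma connected_poly_superlevel:
  fixes p :: "complex poly"
  assumes "degree p \<ge> 1"
  shows "connected {z. cmod (poly p z) > t}"
proof (rule ccontr)
  let ?V = "{z. cmod (poly p z) > t}"
  assume "\<not> connected ?V"
  moreover have "- ?V = {z. cmod (poly p z) \<le> t}"
    by auto
  then have "bounded (- ?V)"
    using bounded_poly_sublevel[OF assms] by simp
  ultimately obtain C where C: "C \<in> components ?V" "bounded C"
    using cobounded_has_bounded_component[of ?V] by auto
  have sub: "C \<subseteq> ?V" and ne: "C \<noteq> {}"
    using C(1) in_components_subset in_components_nonempty by blast+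
  then obtain z where z: "z \<in> C" "cmod (poly p z) > t"
    by blast
  have "cmod (poly p z) \<le> t"
  proof (rule maximum_modulus_frontier[where f = "poly p", OF _ _ C(2) _ z(1)])
    show "poly p holomorphic_on interior C"
      by (intro holomorphic_intros)
    show "continuous_on (closure C) (poly p)"
      by (intro continuous_intros)
    fix w assume "w \<in> frontier C"
    then have "w \<in> frontier ?V"
      using frontier_of_components_subset[OF C(1)] by blast
    then show "cmod (poly p w) \<le> t"
      by (simp add: frontier_def interior_open[OF open_poly_superlevel])
  qed
  with z show False by simp
qed

text \<open>Every component contains a root, and there are finitely many roots. Paths joining them
  below level t0 form a compact set, so |p| has a maximum below t0 on it, and each level above that
  maximum still contains these paths.\<close>

lemma connected_sublevel_downward:
  fixes p :: "complex poly"
  assumes deg: "degree p \<ge> 1" and t0: "t0 > 0" and con: "connected {z. cmod (poly p z) < t0}"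
  shows "\<exists>t1<t0. \<forall>t>t1. t \<le> t0 \<longrightarrow> connected {z. cmod (poly p z) < t}"
proof -
  let ?U = "\<lambda>t. {z. cmod (poly p z) < t}"
  define Z where "Z = {z. poly p z = 0}"
  have "p \<noteq> 0"
    using deg by auto
  then have fin: "finite Z"
    by (simp add: Z_def poly_roots_finite)
  have "\<not> constant (poly p)"
    using deg constant_degree[of p] by simp
  then obtain z0 where z0: "z0 \<in> Z"
    using fundamental_theorem_of_algebra[of p] by (auto simp: Z_def)
  have "path_connected (?U t0)"
    using con open_poly_sublevel connected_open_path_connected by blast
  then have "\<exists>\<gamma>. path \<gamma> \<and> path_image \<gamma> \<subseteq> ?U t0 \<and> pathstart \<gamma> = z0 \<and> pathfinish \<gamma> = z" if "z \<in> Z" for z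
    using that z0 t0 by (auto simp: path_connected_def Z_def)
  then obtain \<gamma> where \<gamma>: "\<And>z. z \<in> Z \<Longrightarrow>
      path (\<gamma> z) \<and> path_image (\<gamma> z) \<subseteq> ?U t0 \<and> pathstart (\<gamma> z) = z0 \<and> pathfinish (\<gamma> z) = z"
    by metis
  define C where "C = (\<Union>z\<in>Z. path_image (\<gamma> z))"
  have z0C: "z0 \<in> path_image (\<gamma> z)" and zC: "z \<in> path_image (\<gamma> z)" if "z \<in> Z" for z
    using \<gamma>[OF that] pathstart_in_path_image[of "\<gamma> z"] pathfinish_in_path_image[of "\<gamma> z"] by auto
  have "compact C"
    unfolding C_def using fin \<gamma> by (intro compact_UN) (auto intro: compact_path_image)
  moreover have "C \<noteq> {}"
    using z0 z0C by (auto simp: C_def)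
  moreover have "continuous_on C (\<lambda>z. cmod (poly p z))"
    by (intro continuous_intros)
  ultimately obtain w where w: "w \<in> C" "\<And>z. z \<in> C \<Longrightarrow> cmod (poly p z) \<le> cmod (poly p w)"
    using continuous_attains_sup[of C] by metis
  have conC: "connected C"
    unfolding C_def
  proof (rule connected_Union)
    show "\<And>S. S \<in> (\<lambda>z. path_image (\<gamma> z)) ` Z \<Longrightarrow> connected S"
      using \<gamma> by (auto intro: connected_path_image)
    show "\<Inter>((\<lambda>z. path_image (\<gamma> z)) ` Z) \<noteq> {}"
      using z0C by blast
  qed
  have "connected (?U t)" if t: "cmod (poly p w) < t" for t
  proof -
    have CU: "C \<subseteq> ?U t"
      using w(2) t by force
    have meet: "connected_component_set (?U t) x \<inter> C \<noteq> {}" if "x \<in> ?U t" for x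
    proof -
      have "connected_component_set (?U t) x \<in> components (?U t)"
        using that by (rule componentsI)
      then obtain z where "z \<in> connected_component_set (?U t) x" "poly p z = 0"
        using component_sublevel_contains_root[OF deg] by blast
      then show ?thesis
        using zC[of z] by (auto simp: C_def Z_def)
    qed
    show ?thesis
      unfolding connected_iff_connected_component_eq
      by (intro ballI joinable_connected_component_eq[OF conC CU] meet)
  qed
  moreover have "cmod (poly p w) < t0"
    using w(1) \<gamma> by (auto simp: C_def)
  ultimately show ?thesis by blast
qed

text \<open>
  Near a point of the level curve the map \<open>p\<close> is injective, so the open sublevel set is locally
  the preimage of a convex set there and cannot lie on two sides of a separation.
\<close>
lemma connected_open_sublevel:
  fixes p :: "complex poly"
  assumes deg: "degree p \<ge> 1" and t: "t > 0"
    and con: "connected {z. cmod (poly p z) \<le> t}"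
    and crit: "\<And>z. cmod (poly p z) = t \<Longrightarrow> poly (pderiv p) z \<noteq> 0"
  shows "connected {z. cmod (poly p z) < t}"
proof (rule ccontr)
  let ?U = "{z. cmod (poly p z) < t}" and ?E = "{z. cmod (poly p z) \<le> t}"
  assume "\<not> connected ?U"
  then obtain V W where VW: "open V" "open W" "V \<noteq> {}" "W \<noteq> {}" "V \<inter> W = {}" "V \<union> W = ?U"
  proof -
    obtain A B where AB: "open A" "open B" "?U \<subseteq> A \<union> B" "A \<inter> B \<inter> ?U = {}" "A \<inter> ?U \<noteq> {}" "B \<inter> ?U \<noteq> {}"
      using \<open>\<not> connected ?U\<close> unfolding connected_def by blast
    show ?thesis
      by (rule that[of "A \<inter> ?U" "B \<inter> ?U"]) (use AB in \<open>auto intro: open_Int open_poly_sublevel\<close>)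
  qed
  have cl: "closure V \<union> closure W = ?E"
    using closure_poly_sublevel[OF deg t] VW(6) by (metis closure_Un)
  have "closure V \<inter> closure W \<noteq> {}"
    using connected_closedD[of ?E "closure V" "closure W"] con VW(3,4) cl closure_subset[of V] closure_subset[of W]
    by auto
  then obtain z where z: "z \<in> closure V" "z \<in> closure W"
    by blast
  have nin: "z \<notin> V" "z \<notin> W"
    using z VW open_Int_closure_eq_empty[of V W] open_Int_closure_eq_empty[of W V] by blast+
  have "z \<in> ?E"
    using z cl by blast
  moreover have "z \<notin> ?U"
    unfolding VW(6)[symmetric] using nin by simp
  ultimately have pz: "cmod (poly p z) = t"
    by simp
  have "deriv (poly p) z \<noteq> 0"
    using crit[OF pz] poly_DERIV[of p z] DERIV_imp_deriv by metis
  moreover have "poly p holomorphic_on UNIV"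
    by (intro holomorphic_intros)
  ultimately obtain r where r: "r > 0" "inj_on (poly p) (ball z r)" "open (poly p ` ball z r)"
    using has_complex_derivative_locally_invertible[of "poly p" UNIV z] by auto
  then have "poly p z \<in> poly p ` ball z r"
    by auto
  then obtain d where d: "d > 0" "ball (poly p z) d \<subseteq> poly p ` ball z r"
    using r(3) by (auto elim!: openE)
  define N where "N = ball z r \<inter> poly p -` ball (poly p z) d"
  have "open N"
    unfolding N_def by (intro open_Int open_ball open_vimage continuous_intros)
  have "z \<in> N"
    using r d by (simp add: N_def)
  obtain g where g: "homeomorphism (ball z r) (poly p ` ball z r) (poly p) g"
  proof (rule invariance_of_domain_homeomorphism[of "ball z r" "poly p"])
    show "continuous_on (ball z r) (poly p)"
      by (intro continuous_intros)
  qed (use r in auto)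
  have "N \<inter> ?U = g ` (ball (poly p z) d \<inter> ball 0 t)"
  proof (intro equalityI subsetI)
    fix x assume x: "x \<in> N \<inter> ?U"
    then have "x = g (poly p x)"
      using g by (auto simp: N_def homeomorphism_def)
    then show "x \<in> g ` (ball (poly p z) d \<inter> ball 0 t)"
      using x by (auto simp: N_def)
  next
    fix x assume "x \<in> g ` (ball (poly p z) d \<inter> ball 0 t)"
    then obtain y where y: "x = g y" "y \<in> ball (poly p z) d" "y \<in> ball 0 t"
      by blast
    then have "poly p (g y) = y" "g y \<in> ball z r"
      using g d(2) by (auto simp: homeomorphism_def)
    then show "x \<in> N \<inter> ?U"
      using y by (auto simp: N_def)
  qed
  moreover have "continuous_on (ball (poly p z) d \<inter> ball 0 t) g"
    using g d(2) by (auto simp: homeomorphism_def intro: continuous_on_subset)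
  ultimately have "connected (N \<inter> ?U)"
    by (simp add: connected_continuous_image convex_Int convex_connected)
  moreover have "N \<inter> V \<noteq> {}" "N \<inter> W \<noteq> {}"
    using z \<open>z \<in> N\<close> open_Int_closure_eq_empty[OF \<open>open N\<close>] by blast+
  ultimately show False
    using connectedD[of "N \<inter> ?U" V W] VW by blast
qed

text \<open>Let s be the supremum of the levels with disconnected open sublevel set. The closed
  sublevel set at s is a nested intersection of connected compact sets,
  \<open>connected_open_sublevel\<close> passes to the open one, and
  \<open>connected_sublevel_downward\<close> clears an interval of levels below s, a
  contradiction.\<close>

proposition connected_sublevel:
  fixes p :: "complex poly"
  assumes deg: "degree p \<ge> 1" and "R > 0"
    and crit: "\<And>z. poly (pderiv p) z = 0 \<Longrightarrow> cmod (poly p z) < R"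
    and "t \<ge> R"
  shows "connected {z. cmod (poly p z) \<le> t}"
proof -
  let ?U = "\<lambda>t. {z. cmod (poly p z) < t}"
  define B where "B = {t. t \<ge> R \<and> \<not> connected (?U t)}"
  have "B = {}"
  proof (rule ccontr)
    assume ne: "B \<noteq> {}"
    obtain T where "\<And>t. t \<ge> T \<Longrightarrow> connected (?U t)"
      using large_sublevel_connected[OF deg] by blast
    then have bdd: "bdd_above B"
      by (intro bdd_aboveI[of _ T]) (metis (no_types, lifting) B_def linear mem_Collect_eq)
    define s where "s = Sup B"
    have "s \<ge> R"
      using ne cSup_upper[OF _ bdd] by (fastforce simp: B_def s_def)
    then have "s > 0"
      using \<open>R > 0\<close> by simp
    have above: "connected (?U t)" if "t > s" for t
      using that cSup_upper[OF _ bdd, of t] \<open>s \<ge> R\<close> by (force simp: B_def s_def)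
    define S where "S = (\<lambda>n::nat. {z. cmod (poly p z) \<le> s + inverse (real (Suc n))})"
    have "connected (\<Inter> (range S))"
    proof (rule connected_nest)
      show "compact (S n)" for n
        unfolding S_def by (rule compact_poly_sublevel[OF deg])
      show "connected (S n)" for n
      proof -
        have "connected (?U (s + inverse (real (Suc n))))"
          by (rule above) simp
        then have "connected (closure (?U (s + inverse (real (Suc n)))))"
          by (rule connected_imp_connected_closure)
        then show ?thesis
          using \<open>s > 0\<close> by (subst (asm) closure_poly_sublevel[OF deg]) (auto simp: S_def add_pos_pos)
      qed
      show "S n \<subseteq> S m" if "m \<le> n" for m n
      proof -
        have "inverse (real (Suc n)) \<le> inverse (real (Suc m))"
          using that by (intro le_imp_inverse_le) auto
        then show ?thesis
          unfolding S_def by (fastforce simp del: inverse_le_iff_le of_nat_Suc)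
      qed
    qed
    moreover have "\<Inter> (range S) = {z. cmod (poly p z) \<le> s}"
    proof (intro equalityI subsetI)
      fix z assume z: "z \<in> \<Inter> (range S)"
      have "cmod (poly p z) \<le> s + e" if e: "e > 0" for e
      proof -
        obtain n where "inverse (real (Suc n)) < e"
          using reals_Archimedean[OF e] by blast
        moreover have "cmod (poly p z) \<le> s + inverse (real (Suc n))"
          using z by (auto simp: S_def)
        ultimately show ?thesis by simp
      qed
      then show "z \<in> {z. cmod (poly p z) \<le> s}"
        using field_le_epsilon by blast
    next
      fix z assume "z \<in> {z. cmod (poly p z) \<le> s}"
      then show "z \<in> \<Inter> (range S)"
        by (auto simp: S_def intro: order_trans)
    qed
    ultimately have "connected (?U s)"
      using \<open>s > 0\<close> \<open>s \<ge> R\<close> crit by (intro connected_open_sublevel[OF deg]) force+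
    then obtain t1 where t1: "t1 < s" "\<And>t. t1 < t \<Longrightarrow> t \<le> s \<Longrightarrow> connected (?U t)"
      using connected_sublevel_downward[OF deg \<open>s > 0\<close>] by blast
    then obtain t where "t \<in> B" "t1 < t"
      using less_cSup_iff[OF ne bdd] by (auto simp: s_def)
    moreover have "t \<le> s"
      using cSup_upper[OF \<open>t \<in> B\<close> bdd] by (simp add: s_def)
    ultimately show False
      using t1(2) by (auto simp: B_def)
  qed
  then have "connected (closure (?U t))"
    using assms(4) by (intro connected_imp_connected_closure) (auto simp: B_def)
  then show ?thesis
    using closure_poly_sublevel[OF deg, of t] assms by simp
qed

section \<open>Comparison of capacities through leading coefficients\<close>

text \<open>
  Bernstein--Walsh comparison of capacities: the maximum principle for \<open>q\<^sup>d / p\<^sup>e\<close> on the outside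
  of the lemniscate of \<open>p\<close>, including the point at infinity. In the coordinate \<open>w = 1/z\<close> the
  quotient is built from the reflected polynomials.
\<close>
lemma lead_coeff_comparison_aux:
  fixes p q :: "complex poly"
  assumes deg: "degree p \<ge> 1" and R': "R' > 0" and root: "poly p 0 = 0"
    and le: "\<And>z. cmod (poly p z) = R' \<Longrightarrow> cmod (poly q z) \<le> R"
  shows "cmod (lead_coeff q) ^ degree p * R' ^ degree q \<le> R ^ degree p * cmod (lead_coeff p) ^ degree q"
proof -
  define d e where "d = degree p" and "e = degree q"
  define W where "W = {w. cmod (poly (reflect_poly p) w) > R' * cmod w ^ d}"
  define F where "F = (\<lambda>w. poly (reflect_poly q) w ^ d / poly (reflect_poly p) w ^ e)"
  have "p \<noteq> 0"
    using deg by auto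
  have at: "cmod (poly (reflect_poly s) w) = cmod w ^ degree s * cmod (poly s (inverse w))"
    if "w \<noteq> 0" for s :: "complex poly" and w
    using that by (simp add: poly_reflect_poly_nz norm_mult norm_power)
  have "open W"
    unfolding W_def by (intro open_Collect_less continuous_intros)
  have clW: "closure W \<subseteq> {w. R' * cmod w ^ d \<le> cmod (poly (reflect_poly p) w)}"
    by (intro closure_minimal closed_Collect_le continuous_intros) (auto simp: W_def)
  have frW: "cmod (poly (reflect_poly p) w) = R' * cmod w ^ d" if "w \<in> frontier W" for w
    using that clW \<open>open W\<close> by (auto simp: frontier_def interior_open W_def)
  have nz: "poly (reflect_poly p) w \<noteq> 0" if "w \<in> closure W" for w
  proof (cases "w = 0")
    case True
    then show ?thesis using \<open>p \<noteq> 0\<close> by simp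
  next
    case False
    then have "0 < R' * cmod w ^ d"
      using R' by simp
    then show ?thesis using that clW by auto
  qed
  have "isCont (\<lambda>z. cmod (poly p z)) 0"
    by (intro continuous_intros)
  then obtain \<delta> where \<delta>: "\<delta> > 0" "\<And>z. cmod z < \<delta> \<Longrightarrow> cmod (poly p z) < R'"
    using R' root unfolding continuous_at_eps_delta by (metis dist_0_norm dist_commute abs_norm_cancel diff_zero dist_real_def norm_zero)
  have "bounded W"
    unfolding bounded_iff
  proof (intro exI[of _ "inverse \<delta>"] ballI)
    fix w assume w: "w \<in> W"
    show "cmod w \<le> inverse \<delta>"
    proof (cases "w = 0")
      case False
      then have "R' < cmod (poly p (inverse w))"
        using w by (simp add: W_def at d_def)
      then have "\<delta> \<le> cmod (inverse w)"
        using \<delta>(2)[of "inverse w"] by force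
      then show ?thesis
        using \<delta>(1) le_imp_inverse_le[of \<delta> "cmod (inverse w)"] by (simp add: norm_inverse)
    qed (use \<delta> in auto)
  qed
  \<comment> \<open>The point 0 is infinity in the coordinate 1/z, and a reflected polynomial takes
    its leading coefficient there. This bound is the claim up to clearing denominators.\<close>
  have "cmod (F 0) \<le> R ^ d / R' ^ e"
  proof (rule maximum_modulus_frontier[where f = F and S = W])
    show "F holomorphic_on interior W"
    proof -
      have "poly (reflect_poly p) w ^ e \<noteq> 0" if "w \<in> interior W" for w
        using nz[of w] that interior_subset[of W] closure_subset[of W] by auto
      then show ?thesis
        unfolding F_def by (intro holomorphic_intros)
    qed
    show "continuous_on (closure W) F"
      unfolding F_def using nz by (intro continuous_intros) auto
    show "bounded W" by fact
    show "0 \<in> W"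
      using \<open>p \<noteq> 0\<close> deg by (simp add: W_def d_def power_0_left)
    fix w assume w: "w \<in> frontier W"
    then have "w \<in> closure W"
      by (simp add: frontier_def)
    then have rpw: "cmod (poly (reflect_poly p) w) \<noteq> 0"
      using nz by simp
    then have w0: "w \<noteq> 0"
      using frW[OF w] deg by (auto simp: d_def power_0_left)
    then have "cmod (poly p (inverse w)) = R'"
      using frW[OF w] at[OF w0, of p] by (simp add: d_def)
    then have "cmod (poly (reflect_poly q) w) \<le> cmod w ^ e * R"
      unfolding at[OF w0] e_def by (intro mult_left_mono le) auto
    then have "cmod (poly (reflect_poly q) w) ^ d \<le> (cmod w ^ e * R) ^ d"
      by (intro power_mono) auto
    then have "cmod (F w) \<le> (cmod w ^ e * R) ^ d / (R' * cmod w ^ d) ^ e"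
      unfolding F_def by (simp add: norm_divide norm_power frW[OF w] divide_right_mono R' less_imp_le)
    also have "\<dots> = R ^ d / R' ^ e"
      using w0 by (simp add: power_mult_distrib power_mult[symmetric] mult.commute)
    finally show "cmod (F w) \<le> R ^ d / R' ^ e" .
  qed
  then show ?thesis
    using R' \<open>p \<noteq> 0\<close> by (simp add: F_def norm_divide norm_power d_def e_def field_simps)
qed

text \<open>Moving a root c of p to 0 changes neither degrees nor leading coefficients. With a root
  at 0, the outside of the lemniscate is bounded in the coordinate 1/z, as the maximum principle
  requires.\<close>

lemma lead_coeff_comparison:
  fixes p q :: "complex poly"
  assumes deg: "degree p \<ge> 1" and R': "R' > 0"
    and le: "\<And>z. cmod (poly p z) = R' \<Longrightarrow> cmod (poly q z) \<le> R"
  shows "cmod (lead_coeff q) ^ degree p * R' ^ degree q \<le> R ^ degree p * cmod (lead_coeff p) ^ degree q"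
proof -
  have "\<not> constant (poly p)"
    using deg constant_degree[of p] by simp
  then obtain c where c: "poly p c = 0"
    using fundamental_theorem_of_algebra[of p] by auto
  have "cmod (lead_coeff (q \<circ>\<^sub>p [:c, 1:])) ^ degree (p \<circ>\<^sub>p [:c, 1:]) * R' ^ degree (q \<circ>\<^sub>p [:c, 1:])
    \<le> R ^ degree (p \<circ>\<^sub>p [:c, 1:]) * cmod (lead_coeff (p \<circ>\<^sub>p [:c, 1:])) ^ degree (q \<circ>\<^sub>p [:c, 1:])"
    using c le deg by (intro lead_coeff_comparison_aux R') (auto simp: poly_pcompose degree_pcompose)
  moreover have "lead_coeff (s \<circ>\<^sub>p [:c, 1:]) = lead_coeff s" for s :: "complex poly"
    by (subst lead_coeff_comp) auto
  ultimately show ?thesis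
    unfolding degree_pcompose by (simp add: degree_pcompose)
qed

section \<open>Normality and the chordal distance\<close>

text \<open>Schottky's theorem for the closed unit disc, rescaled. The radius 3/4 \<rho> keeps the
  closed disc inside the open ball and turns the half ball into the disc of radius 2/3, whence 26 =
  2 + 12 (2/3) / (1 - 2/3).\<close>

lemma Schottky_ball:
  assumes hol: "f holomorphic_on ball z \<rho>" and "\<rho> > 0"
    and omit: "\<And>w. w \<in> ball z \<rho> \<Longrightarrow> f w \<noteq> 0 \<and> f w \<noteq> 1"
    and r: "cmod (f z) \<le> r" and w: "w \<in> cball z (\<rho> / 2)"
  shows "cmod (f w) \<le> exp (pi * exp (pi * (26 + 2 * r)))"
proof -
  define c where "c = complex_of_real (3 / 4 * \<rho>)"
  have c: "cmod c = 3 / 4 * \<rho>" "c \<noteq> 0"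
    using \<open>\<rho> > 0\<close> by (auto simp: c_def norm_mult simp del: of_real_mult of_real_divide)
  have in_ball: "z + c * \<zeta> \<in> ball z \<rho>" if "\<zeta> \<in> cball 0 1" for \<zeta>
  proof -
    have "cmod (c * \<zeta>) \<le> 3 / 4 * \<rho> * 1"
      unfolding norm_mult c using that \<open>\<rho> > 0\<close> by (intro mult_left_mono) auto
    then show ?thesis
      using \<open>\<rho> > 0\<close> by (simp add: dist_norm)
  qed
  define g where "g = (\<lambda>\<zeta>. f (z + c * \<zeta>))"
  define \<zeta> where "\<zeta> = (w - z) / c"
  have "cmod (g \<zeta>) \<le> exp (pi * exp (pi * (2 + 2 * r + 12 * (2/3) / (1 - 2/3))))"
  proof (rule Schottky[where f = g and t = "2/3"])
    show "g holomorphic_on cball 0 1"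
    proof -
      have "(\<lambda>\<zeta>. z + c * \<zeta>) holomorphic_on cball 0 1"
        by (intro holomorphic_intros)
      from holomorphic_on_compose_gen[OF this hol] in_ball show ?thesis
        unfolding g_def comp_def by blast
    qed
    show "cmod (g 0) \<le> r"
      using r by (simp add: g_def)
    show "\<not> (g \<xi> = 0 \<or> g \<xi> = 1)" if "\<xi> \<in> cball 0 1" for \<xi>
      using omit in_ball[OF that] by (auto simp: g_def)
    have "cmod (w - z) \<le> \<rho> / 2"
      using w by (simp add: dist_norm norm_minus_commute)
    then show "cmod \<zeta> \<le> 2/3"
      using \<open>\<rho> > 0\<close> by (simp add: \<zeta>_def norm_divide c field_simps)
  qed simp_all
  moreover have "g \<zeta> = f w"
    using c by (simp add: g_def \<zeta>_def)
  ultimately show ?thesis by simp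
qed

text \<open>As \<open>l\<close> takes values in the sphere, locally uniform convergence to infinity
  is included.\<close>

definition normal_sequence_on :: "complex set \<Rightarrow> (nat \<Rightarrow> complex \<Rightarrow> complex) \<Rightarrow> bool" where
  "normal_sequence_on S f \<longleftrightarrow> (\<exists>r l. strict_mono (r :: nat \<Rightarrow> nat) \<and>
     (\<forall>K. compact K \<longrightarrow> K \<subseteq> S \<longrightarrow>
        uniform_limit K (\<lambda>n w. stereo (Some (f (r n) w))) (\<lambda>w. stereo (l w)) sequentially))"

lemma normal_sequence_on_subseq:
  assumes "strict_mono s" "normal_sequence_on S (\<lambda>n. f (s n))"
  shows "normal_sequence_on S f"
proof -
  obtain r l where "strict_mono (r :: nat \<Rightarrow> nat)" "\<forall>K. compact K \<longrightarrow> K \<subseteq> S \<longrightarrow>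
        uniform_limit K (\<lambda>n w. stereo (Some (f (s (r n)) w))) (\<lambda>w. stereo (l w)) sequentially"
    using assms(2) unfolding normal_sequence_on_def by auto
  then show ?thesis
    unfolding normal_sequence_on_def using strict_mono_o[OF assms(1), of r]
    by (intro exI[of _ "s \<circ> r"] exI[of _ l]) (simp add: comp_def)
qed

text \<open>Montel's theorem for the bounded maps u, carried to the sphere by T, which is chordally
  uniformly continuous on the compact disc of radius B. T will be affine, or have a pole at 0 when f
  may tend to infinity.\<close>

lemma normal_sequence_on_transfer:
  assumes "open S" and hol: "\<And>n. u n holomorphic_on S"
    and bdd: "\<And>n w. w \<in> S \<Longrightarrow> cmod (u n w) \<le> B"
    and T: "continuous_on UNIV (\<lambda>w. stereo (T w))"
    and f: "\<And>n w. w \<in> S \<Longrightarrow> T (u n w) = Some (f n w)"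
  shows "normal_sequence_on S f"
proof -
  obtain g r where gr: "strict_mono (r :: nat \<Rightarrow> nat)"
      "\<And>K. compact K \<Longrightarrow> K \<subseteq> S \<Longrightarrow> uniform_limit K (u \<circ> r) g sequentially"
  proof (rule Montel[of S "range u" u])
    show "\<exists>B. \<forall>h\<in>range u. \<forall>z\<in>K. cmod (h z) \<le> B" if "compact K" "K \<subseteq> S" for K
      using bdd that by blast
  qed (use \<open>open S\<close> hol in auto)
  have unif: "uniformly_continuous_on (cball 0 B) (\<lambda>w. stereo (T w))"
    using T by (intro compact_uniformly_continuous) (auto intro: continuous_on_subset)
  have "uniform_limit K (\<lambda>n w. stereo (Some (f (r n) w))) (\<lambda>w. stereo (T (g w))) sequentially"
    if K: "compact K" "K \<subseteq> S" for K
  proof -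
    have "uniform_limit K (\<lambda>n w. stereo (T ((u \<circ> r) n w))) (\<lambda>w. stereo (T (g w))) sequentially"
    proof (rule uniform_limit_compose_uniformly_continuous_on[OF gr(2)[OF K] unif])
      show "\<forall>\<^sub>F n in sequentially. \<forall>w\<in>K. (u \<circ> r) n w \<in> cball 0 B"
        using K(2) bdd by (intro always_eventually) (auto dest: subsetD)
    qed simp
    moreover have "stereo (T ((u \<circ> r) n w)) = stereo (Some (f (r n) w))" if "w \<in> K" for n w
      using f[of w "r n"] that K by auto
    ultimately show ?thesis
      by (simp add: uniform_limit_iff)
  qed
  then show ?thesis
    unfolding normal_sequence_on_def using gr(1) by (intro exI[of _ r] exI[of _ "\<lambda>w. T (g w)"]) auto
qed

lemma sum_squares_cmod_ne_0: "(cmod z)\<^sup>2 + 1 \<noteq> 0"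
  using zero_le_power2[of "cmod z"] by linarith

lemma continuous_on_stereo_Some: "continuous_on UNIV (\<lambda>z. stereo (Some z))"
  unfolding stereo_def option.case by (intro continuous_intros) (simp_all add: sum_squares_cmod_ne_0)

text \<open>Clearing denominators gives a formula that is regular at 0; D has no zero because w and
  a w + c do not vanish together.\<close>

lemma continuous_on_stereo_Moebius:
  assumes "c \<noteq> 0"
  shows "continuous_on UNIV (\<lambda>w. stereo (if w = 0 then None else Some (a + c / w)))"
proof -
  define D where "D = (\<lambda>w. (cmod (a * w + c))\<^sup>2 + (cmod w)\<^sup>2)"
  have D: "D w \<noteq> 0" for w
    using assms by (auto simp: D_def sum_power2_eq_zero_iff)
  have "stereo (if w = 0 then None else Some (a + c / w))
      = ((2 / D w) *\<^sub>R ((a * w + c) * cnj w), ((cmod (a * w + c))\<^sup>2 - (cmod w)\<^sup>2) / D w)" for w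
  proof (cases "w = 0")
    case True
    then show ?thesis using assms by (simp add: stereo_def D_def)
  next
    case False
    define z where "z = a + c / w"
    have zw: "a * w + c = z * w"
      using False by (simp add: z_def field_simps)
    have Dw: "D w = ((cmod z)\<^sup>2 + 1) * (cmod w)\<^sup>2"
      unfolding D_def zw by (simp add: norm_mult power_mult_distrib algebra_simps)
    have "(2 / D w) *\<^sub>R ((a * w + c) * cnj w) = (2 / D w * (cmod w)\<^sup>2) *\<^sub>R z"
      unfolding zw using complex_norm_square[of w] by (simp add: scaleR_conv_of_real mult_ac)
    also have "2 / D w * (cmod w)\<^sup>2 = 2 / ((cmod z)\<^sup>2 + 1)"
      using False by (simp add: Dw)
    finally have 1: "(2 / D w) *\<^sub>R ((a * w + c) * cnj w) = (2 / ((cmod z)\<^sup>2 + 1)) *\<^sub>R z" .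
    have "((cmod (a * w + c))\<^sup>2 - (cmod w)\<^sup>2) / D w = (((cmod z)\<^sup>2 - 1) * (cmod w)\<^sup>2) / (((cmod z)\<^sup>2 + 1) * (cmod w)\<^sup>2)"
      unfolding Dw zw by (simp add: norm_mult power_mult_distrib algebra_simps)
    also have "\<dots> = ((cmod z)\<^sup>2 - 1) / ((cmod z)\<^sup>2 + 1)"
      using False by simp
    finally show ?thesis
      using False 1 by (simp add: stereo_def z_def[symmetric])
  qed
  moreover have "continuous_on UNIV
      (\<lambda>w. ((2 / D w) *\<^sub>R ((a * w + c) * cnj w), ((cmod (a * w + c))\<^sup>2 - (cmod w)\<^sup>2) / D w))"
  proof -
    have "continuous_on UNIV D"
      unfolding D_def by (intro continuous_intros)
    then show ?thesis
      using D by (intro continuous_intros) auto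
  qed
  ultimately show ?thesis by simp
qed

lemma normal_sequence_on_bounded:
  assumes "open S" "\<And>n. f n holomorphic_on S" "\<And>n w. w \<in> S \<Longrightarrow> cmod (f n w) \<le> B"
  shows "normal_sequence_on S f"
  by (rule normal_sequence_on_transfer[OF assms continuous_on_stereo_Some]) auto

text \<open>Montel's criterion. With the omitted values normalized to 0 and 1, infinitely many u or
  infinitely many 1/u have modulus at most 1 at the centre, and Schottky bounds these on the half
  ball.\<close>

proposition normal_sequence_on_omitting:
  assumes hol: "\<And>n. f n holomorphic_on ball z \<rho>" and "\<rho> > 0" and "a \<noteq> b"
    and omit: "\<And>n w. w \<in> ball z \<rho> \<Longrightarrow> f n w \<noteq> a \<and> f n w \<noteq> b"
  shows "normal_sequence_on (ball z (\<rho> / 2)) f"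
proof -
  define u where "u = (\<lambda>n w. (f n w - a) / (b - a))"
  have u01: "u n w \<noteq> 0 \<and> u n w \<noteq> 1" if "w \<in> ball z \<rho>" for n w
    using omit[OF that, of n] \<open>a \<noteq> b\<close> by (auto simp: u_def)
  have holu: "u n holomorphic_on ball z \<rho>" for n
    unfolding u_def using \<open>a \<noteq> b\<close> by (intro holomorphic_intros hol) auto
  have sub: "ball z (\<rho> / 2) \<subseteq> ball z \<rho>" "ball z (\<rho> / 2) \<subseteq> cball z (\<rho> / 2)"
    using \<open>\<rho> > 0\<close> by auto
  have "infinite {n. cmod (u n z) \<le> 1} \<or> infinite {n. cmod (u n z) \<ge> 1}"
  proof (rule ccontr)
    assume "\<not> ?thesis"
    then have "finite ({n. cmod (u n z) \<le> 1} \<union> {n. cmod (u n z) \<ge> 1})"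
      by simp
    moreover have "{n. cmod (u n z) \<le> 1} \<union> {n. cmod (u n z) \<ge> 1} = UNIV"
      by auto
    ultimately show False by simp
  qed
  then show ?thesis
  proof
    assume "infinite {n. cmod (u n z) \<le> 1}"
    then obtain s where s: "strict_mono (s :: nat \<Rightarrow> nat)" "\<And>n. cmod (u (s n) z) \<le> 1"
      using infinite_enumerate by blast
    have "normal_sequence_on (ball z (\<rho> / 2)) (\<lambda>n. f (s n))"
    proof (rule normal_sequence_on_transfer)
      show "(\<lambda>w. u (s n) w) holomorphic_on ball z (\<rho> / 2)" for n
        using holu sub(1) holomorphic_on_subset by blast
      show "cmod (u (s n) w) \<le> exp (pi * exp (pi * (26 + 2 * 1)))" if "w \<in> ball z (\<rho> / 2)" for n w
        using that sub(2) by (intro Schottky_ball[OF holu \<open>\<rho> > 0\<close> u01 s(2)]) auto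
      show "continuous_on UNIV (\<lambda>w. stereo (Some (a + (b - a) * w)))"
      proof -
        have "continuous_on UNIV (\<lambda>w. a + (b - a) * w)"
          by (intro continuous_intros)
        from continuous_on_compose2[OF continuous_on_stereo_Some this] show ?thesis
          by simp
      qed
      show "Some (a + (b - a) * u (s n) w) = Some (f (s n) w)" for n w
        using \<open>a \<noteq> b\<close> by (simp add: u_def)
    qed simp
    then show ?thesis
      using normal_sequence_on_subseq[OF s(1)] by simp
  next
    assume "infinite {n. cmod (u n z) \<ge> 1}"
    then obtain s where s: "strict_mono (s :: nat \<Rightarrow> nat)" "\<And>n. cmod (u (s n) z) \<ge> 1"
      using infinite_enumerate by blast
    define v where "v = (\<lambda>n w. inverse (u (s n) w))"
    have v01: "v n w \<noteq> 0 \<and> v n w \<noteq> 1" if "w \<in> ball z \<rho>" for n w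
      using u01[OF that, of "s n"] by (simp add: v_def)
    have holv: "v n holomorphic_on ball z \<rho>" for n
      unfolding v_def using u01 by (intro holomorphic_intros holu) auto
    have "normal_sequence_on (ball z (\<rho> / 2)) (\<lambda>n. f (s n))"
    proof (rule normal_sequence_on_transfer)
      show "v n holomorphic_on ball z (\<rho> / 2)" for n
        using holv sub(1) holomorphic_on_subset by blast
      have "cmod (v n z) \<le> 1" for n
        using s(2)[of n] by (simp add: v_def norm_inverse inverse_le_1_iff)
      then show "cmod (v n w) \<le> exp (pi * exp (pi * (26 + 2 * 1)))" if "w \<in> ball z (\<rho> / 2)" for n w
        using that sub(2) by (intro Schottky_ball[OF holv \<open>\<rho> > 0\<close> v01]) auto
      show "continuous_on UNIV (\<lambda>w. stereo (if w = 0 then None else Some (a + (b - a) / w)))"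
        using \<open>a \<noteq> b\<close> by (intro continuous_on_stereo_Moebius) auto
      show "(if v n w = 0 then None else Some (a + (b - a) / v n w)) = Some (f (s n) w)"
        if "w \<in> ball z (\<rho> / 2)" for n w
      proof -
        have "v n w \<noteq> 0"
          using v01 that sub(1) by blast
        then show ?thesis
          using \<open>a \<noteq> b\<close> by (simp add: v_def u_def)
      qed
    qed simp
    then show ?thesis
      using normal_sequence_on_subseq[OF s(1)] by simp
  qed
qed

section \<open>Chordal distance near infinity and passage to the sphere\<close>

lemma dist_stereo_infinity: "dist (stereo (Some w)) (stereo None) = 2 / sqrt ((cmod w)\<^sup>2 + 1)"
proof -
  define s where "s = (cmod w)\<^sup>2 + 1"
  have s: "s > 0"
    using sum_squares_cmod_ne_0[of w] by (simp add: s_def add_nonneg_pos)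
  have "(s - 2) / s - 1 = - 2 / s"
    using s by (simp add: field_simps)
  then have "dist (stereo (Some w)) (stereo None) = sqrt ((2 / s)\<^sup>2 * (s - 1) + (2 / s)\<^sup>2)"
    by (simp add: stereo_def dist_norm norm_Pair s_def power_mult_distrib power_divide)
  also have "(2 / s)\<^sup>2 * (s - 1) + (2 / s)\<^sup>2 = 2\<^sup>2 / s"
    using s by (simp add: power2_eq_square field_simps)
  also have "sqrt (2\<^sup>2 / s) = 2 / sqrt s"
    by (simp add: real_sqrt_divide)
  finally show ?thesis
    by (simp add: s_def)
qed

lemma dist_stereo_infinity_le:
  assumes "M > 0" "cmod w \<ge> M"
  shows "dist (stereo (Some w)) (stereo None) \<le> 2 / M"
proof -
  have "M\<^sup>2 \<le> (cmod w)\<^sup>2"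
    using assms by (intro power_mono) auto
  then have "M \<le> sqrt ((cmod w)\<^sup>2 + 1)"
    by (intro real_le_rsqrt) simp
  then show ?thesis
    unfolding dist_stereo_infinity using assms(1) by (intro divide_left_mono mult_pos_pos) (auto intro: add_nonneg_pos)
qed

lemma compactin_Some_image_iff: "compactin riemann_sphere (Some ` C) \<longleftrightarrow> compact C"
proof
  assume "compactin riemann_sphere (Some ` C)"
  moreover have "Hausdorff_space riemann_sphere"
    using stereo_homeomorphic homeomorphic_Hausdorff_space homeomorphic_map_imp_homeomorphic_space
      Hausdorff_space_subtopology Hausdorff_space_euclidean by metis
  ultimately have "closedin riemann_sphere (Some ` C)"
    using compactin_imp_closedin by blast
  then show "compact C"
    by (simp add: riemann_sphere_def)
next
  assume "compact C"
  then show "compactin riemann_sphere (Some ` C)"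
    unfolding riemann_sphere_def by (intro image_compactin[OF _ continuous_map_Some]) simp
qed

lemma normal_family_on_polysI:
  assumes "\<And>p. (\<And>n. p n \<in> P) \<Longrightarrow> normal_sequence_on S (\<lambda>n. poly (p n))"
  shows "normal_family_on (Some ` S) (sphere_poly ` P)"
  unfolding normal_family_on_def
proof (intro allI impI)
  fix f :: "nat \<Rightarrow> complex option \<Rightarrow> complex option"
  assume "range f \<subseteq> sphere_poly ` P"
  then have "\<forall>n. \<exists>q. q \<in> P \<and> f n = sphere_poly q"
    by blast
  then obtain p where p: "\<And>n. p n \<in> P" "\<And>n. f n = sphere_poly (p n)"
    by metis
  obtain r l where rl: "strict_mono (r :: nat \<Rightarrow> nat)" "\<And>C. compact C \<Longrightarrow> C \<subseteq> S \<Longrightarrow>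
        uniform_limit C (\<lambda>n w. stereo (Some (poly (p (r n)) w))) (\<lambda>w. stereo (l w)) sequentially"
    using assms[of p, OF p(1)] unfolding normal_sequence_on_def by blast
  have "uniform_limit C (\<lambda>n. stereo \<circ> f (r n)) (stereo \<circ> (\<lambda>x. l (the x))) sequentially"
    if C: "compactin riemann_sphere C" "C \<subseteq> Some ` S" for C
  proof -
    obtain D where D: "C = Some ` D" "D \<subseteq> S"
      using C(2) by (auto simp: subset_image_iff)
    then have "uniform_limit D (\<lambda>n w. stereo (Some (poly (p (r n)) w))) (\<lambda>w. stereo (l w)) sequentially"
      using C(1) by (intro rl(2)) (simp_all add: compactin_Some_image_iff)
    then show ?thesis
      by (simp add: uniform_limit_iff D p(2) sphere_poly_def)
  qed
  then show "\<exists>r. strict_mono r \<and> (\<exists>l. \<forall>C. compactin riemann_sphere C \<and> C \<subseteq> Some ` S \<longrightarrow>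
      uniform_limit C (\<lambda>n. stereo \<circ> f (r n)) (stereo \<circ> l) sequentially)"
    using rl(1) by (intro exI[of _ r] conjI exI[of _ "\<lambda>x. l (the x)"] allI impI) auto
qed

section \<open>Words in the generators\<close>

text \<open>The first letter acts first, so the prefixes of a code give the successive maps along
  it.\<close>

fun word_poly :: "(nat \<Rightarrow> complex poly) \<Rightarrow> nat list \<Rightarrow> complex poly" where
  "word_poly h [] = [:0, 1:]"
| "word_poly h (j # w) = word_poly h w \<circ>\<^sub>p h j"

lemma word_poly_append: "word_poly h (u @ w) = word_poly h w \<circ>\<^sub>p word_poly h u"
  by (induction u) (simp_all add: pcompose_assoc)

lemma Psi_pcompose:
  assumes "p \<noteq> 0" "degree q \<ge> 1"
  shows "Psi (p \<circ>\<^sub>p q) x = Psi p (Psi q x)"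
proof -
  have "lead_coeff p \<noteq> 0" "lead_coeff q \<noteq> 0"
    using assms by auto
  moreover have "lead_coeff (p \<circ>\<^sub>p q) = lead_coeff p * lead_coeff q ^ degree p"
    using assms by (intro lead_coeff_comp) auto
  ultimately show ?thesis
    unfolding Psi_def by (simp add: degree_pcompose norm_mult norm_power ln_mult ln_realpow algebra_simps)
qed

text \<open>R is an escape radius and also a bound for all critical values; v will lie in every K.
  \<open>Psi_covers\<close> is the covering hypothesis of the theorem, and
  \<open>Psi_reflects\<close> holds because [\<alpha>, \<beta>] contains the repelling fixed points
  of all \<open>Psi (h j)\<close>.\<close>

locale word_system =
  fixes I :: "nat set" and h :: "nat \<Rightarrow> complex poly" and R :: real and v :: complex and \<alpha> \<beta> :: real
  assumes finite_I: "finite I" and I_ne: "I \<noteq> {}"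
    and degree_h: "\<And>j. j \<in> I \<Longrightarrow> degree (h j) \<ge> 2"
    and R_pos: "R > 0"
    and escape: "\<And>j z. j \<in> I \<Longrightarrow> cmod z \<ge> R \<Longrightarrow> cmod (poly (h j) z) \<ge> 2 * cmod z"
    and critical: "\<And>w z. set w \<subseteq> I \<Longrightarrow> poly (pderiv (word_poly h w)) z = 0 \<Longrightarrow> cmod (poly (word_poly h w) z) < R"
    and v: "\<And>w. set w \<subseteq> I \<Longrightarrow> cmod (poly (word_poly h w) v) \<le> R"
    and \<alpha>_le_\<beta>: "\<alpha> \<le> \<beta>" and \<beta>_le: "\<beta> \<le> ln R"
    and Psi_reflects: "\<And>j x. j \<in> I \<Longrightarrow> Psi (h j) x \<in> {\<alpha>..\<beta>} \<Longrightarrow> x \<in> {\<alpha>..\<beta>}"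
    and Psi_covers: "\<And>x. x \<in> {\<alpha>..\<beta>} \<Longrightarrow> \<exists>j\<in>I. Psi (h j) x \<in> {\<alpha>..\<beta>}"
begin

definition iter :: "(nat \<Rightarrow> nat) \<Rightarrow> nat \<Rightarrow> complex poly" where
  "iter \<omega> n = word_poly h (map \<omega> [0..<n])"

definition codes :: "(nat \<Rightarrow> nat) set" where
  "codes = {\<omega>. \<forall>n. \<omega> n \<in> I}"

text \<open>For \<omega> in \<open>codes\<close>, an orbit that leaves the disc of radius R at least
  doubles its modulus at each later step, so staying in this disc is the same as being
  bounded.\<close>

definition K :: "(nat \<Rightarrow> nat) \<Rightarrow> complex set" where
  "K \<omega> = {z. \<forall>n. cmod (poly (iter \<omega> n) z) \<le> R}"

definition J :: "(nat \<Rightarrow> nat) \<Rightarrow> complex set" where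
  "J \<omega> = frontier (K \<omega>)"

text \<open>
  \<open>coded \<omega> x\<close> says that \<open>x\<close> is the logarithmic capacity of \<open>K \<omega>\<close>; it is the only point whose
  orbit along \<open>\<omega>\<close> under the expanding maps \<open>Psi\<close> is bounded.
\<close>
definition coded :: "(nat \<Rightarrow> nat) \<Rightarrow> real \<Rightarrow> bool" where
  "coded \<omega> x \<longleftrightarrow> (\<forall>n. Psi (iter \<omega> n) x \<in> {\<alpha>..\<beta>})"

lemma iter_0: "iter \<omega> 0 = [:0, 1:]"
  by (simp add: iter_def)

lemma iter_Suc: "iter \<omega> (Suc n) = h (\<omega> n) \<circ>\<^sub>p iter \<omega> n"
  by (simp add: iter_def word_poly_append pcompose_pCons)

lemma iter_add: "iter \<omega> (n + k) = iter (\<lambda>i. \<omega> (n + i)) k \<circ>\<^sub>p iter \<omega> n"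
proof -
  have "map \<omega> [0..<n + k] = map \<omega> [0..<n] @ map (\<lambda>i. \<omega> (n + i)) [0..<k]"
    by (rule nth_equalityI) (auto simp: nth_append)
  then show ?thesis
    by (simp add: iter_def word_poly_append)
qed

lemma iter_cong: "(\<And>i. i < n \<Longrightarrow> \<omega> i = \<tau> i) \<Longrightarrow> iter \<omega> n = iter \<tau> n"
  unfolding iter_def by (rule arg_cong[of _ _ "word_poly h"]) auto

lemma codes_shift: "\<omega> \<in> codes \<Longrightarrow> (\<lambda>i. \<omega> (n + i)) \<in> codes"
  by (simp add: codes_def)

lemma codes_word: "\<omega> \<in> codes \<Longrightarrow> set (map \<omega> [0..<n]) \<subseteq> I"
  by (auto simp: codes_def)

lemma degree_iter: "\<omega> \<in> codes \<Longrightarrow> degree (iter \<omega> n) \<ge> 2 ^ n"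
proof (induction n)
  case (Suc n)
  then have "2 * 2 ^ n \<le> degree (h (\<omega> n)) * degree (iter \<omega> n)"
    by (intro mult_le_mono degree_h) (auto simp: codes_def)
  then show ?case
    by (simp add: iter_Suc degree_pcompose)
qed (simp add: iter_0)

lemma degree_iter_ge_1: "\<omega> \<in> codes \<Longrightarrow> degree (iter \<omega> n) \<ge> 1"
  using degree_iter[of \<omega> n] one_le_power[of "2::nat" n] by linarith

lemma word_poly_escape:
  assumes "set w \<subseteq> I" "cmod z \<ge> R"
  shows "cmod (poly (word_poly h w) z) \<ge> 2 ^ length w * cmod z"
  using assms
proof (induction w arbitrary: z)
  case (Cons j w)
  have step: "2 * cmod z \<le> cmod (poly (h j) z)"
    using Cons.prems by (intro escape) auto
  then have "2 ^ length w * cmod (poly (h j) z) \<le> cmod (poly (word_poly h w) (poly (h j) z))"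
    using Cons.prems R_pos by (intro Cons.IH) auto
  moreover have "2 ^ length w * (2 * cmod z) \<le> 2 ^ length w * cmod (poly (h j) z)"
    using step by (intro mult_left_mono) auto
  ultimately have "2 ^ length w * (2 * cmod z) \<le> cmod (poly (word_poly h w) (poly (h j) z))"
    by linarith
  then show ?case
    by (simp add: poly_pcompose mult_ac)
qed simp

text \<open>The source of strictness later on: one step back improves the level from 2R to
  R.\<close>

lemma iter_Suc_small:
  assumes "\<omega> \<in> codes" "cmod (poly (iter \<omega> (Suc n)) z) \<le> 2 * R"
  shows "cmod (poly (iter \<omega> n) z) \<le> R"
proof (rule ccontr)
  assume "\<not> ?thesis"
  then have "2 * cmod (poly (iter \<omega> n) z) \<le> cmod (poly (iter \<omega> (Suc n)) z)"
    using assms(1) escape[of "\<omega> n" "poly (iter \<omega> n) z"] by (simp add: iter_Suc poly_pcompose codes_def)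
  with assms(2) \<open>\<not> ?thesis\<close> show False by simp
qed

lemma iter_sublevel_antimono:
  assumes "\<omega> \<in> codes" "m \<le> n" "cmod (poly (iter \<omega> n) z) \<le> R"
  shows "cmod (poly (iter \<omega> m) z) \<le> R"
  using assms(2,3)
proof (induction rule: inc_induct)
  case (step n)
  then show ?case
    using iter_Suc_small[OF assms(1), of n z] R_pos by (cases "cmod (poly (iter \<omega> (Suc n)) z) \<le> R") auto
qed simp

text \<open>Only the times from n on matter, because a small value at a later time forces small
  values before.\<close>

lemma K_shift:
  assumes "\<omega> \<in> codes"
  shows "z \<in> K \<omega> \<longleftrightarrow> poly (iter \<omega> n) z \<in> K (\<lambda>i. \<omega> (n + i))"
proof -
  have "z \<in> K \<omega> \<longleftrightarrow> (\<forall>k. cmod (poly (iter \<omega> (n + k)) z) \<le> R)"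
  proof
    assume *: "\<forall>k. cmod (poly (iter \<omega> (n + k)) z) \<le> R"
    have "cmod (poly (iter \<omega> k) z) \<le> R" for k
      by (rule iter_sublevel_antimono[OF assms _ *[rule_format, of k]]) simp
    then show "z \<in> K \<omega>"
      by (simp add: K_def)
  qed (simp add: K_def)
  also have "\<dots> \<longleftrightarrow> poly (iter \<omega> n) z \<in> K (\<lambda>i. \<omega> (n + i))"
  proof -
    have "poly (iter \<omega> (n + k)) z = poly (iter (\<lambda>i. \<omega> (n + i)) k) (poly (iter \<omega> n) z)" for k
      by (subst iter_add) (rule poly_pcompose)
    then show ?thesis
      by (simp only: K_def mem_Collect_eq)
  qed
  finally show ?thesis .
qed

lemma K_eq_Inter: "K \<omega> = (\<Inter>n. {z. cmod (poly (iter \<omega> n) z) \<le> R})"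
  by (auto simp: K_def)

lemma v_in_K: "\<omega> \<in> codes \<Longrightarrow> v \<in> K \<omega>"
  unfolding K_def iter_def using v codes_word by blast

lemma K_subset: "K \<omega> \<subseteq> cball 0 R"
proof
  fix z assume "z \<in> K \<omega>"
  then have "cmod (poly (iter \<omega> 0) z) \<le> R"
    by (simp add: K_def)
  then show "z \<in> cball 0 R"
    by (simp add: iter_0)
qed

lemma
  assumes "\<omega> \<in> codes"
  shows compact_K: "compact (K \<omega>)" and connected_K: "connected (K \<omega>)"
proof -
  have "closed (K \<omega>)"
    unfolding K_eq_Inter by (intro closed_INT ballI closed_poly_sublevel)
  then show "compact (K \<omega>)"
    using K_subset[of \<omega>] bounded_subset[OF bounded_cball] by (auto simp: compact_eq_bounded_closed)
  show "connected (K \<omega>)"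
    unfolding K_eq_Inter
  proof (rule connected_nest)
    fix n
    show "compact {z. cmod (poly (iter \<omega> n) z) \<le> R}"
      by (rule compact_poly_sublevel[OF degree_iter_ge_1[OF assms]])
    show "connected {z. cmod (poly (iter \<omega> n) z) \<le> R}"
      using critical[OF codes_word[OF assms, of n]]
      by (intro connected_sublevel[OF degree_iter_ge_1[OF assms] R_pos]) (auto simp: iter_def)
  qed (use iter_sublevel_antimono[OF assms] in blast)
qed

lemma closed_K: "\<omega> \<in> codes \<Longrightarrow> closed (K \<omega>)"
  using compact_K compact_imp_closed by blast

text \<open>The complement is a union of connected superlevel sets, all containing the outside of
  the disc of radius R.\<close>

lemma connected_Compl_K:
  assumes "\<omega> \<in> codes"
  shows "connected (- K \<omega>)"
proof -
  define V where "V = (\<lambda>n. {z. cmod (poly (iter \<omega> n) z) > R})"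
  have "- K \<omega> = (\<Union>n. V n)"
    by (simp add: set_eq_iff K_def V_def not_le)
  moreover have "connected (\<Union>n. V n)"
  proof (rule connected_Union)
    show "connected S" if "S \<in> range V" for S
      using that connected_poly_superlevel[OF degree_iter_ge_1[OF assms]] by (auto simp: V_def)
    have "V 0 \<subseteq> V n" for n
      using iter_sublevel_antimono[OF assms, of 0 n] by (auto simp: V_def simp flip: not_le)
    moreover have "complex_of_real (R + 1) \<in> V 0"
      using R_pos by (simp add: V_def iter_0 del: of_real_add)
    ultimately show "\<Inter> (range V) \<noteq> {}"
      by blast
  qed
  ultimately show ?thesis by simp
qed

section \<open>Nesting of the sets K and strict comparison of capacities\<close>

lemma connected_J: "\<omega> \<in> codes \<Longrightarrow> connected (J \<omega>)"
  by (simp add: J_def connected_frontier_simple connected_K connected_Compl_K)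

lemma J_subset_K: "\<omega> \<in> codes \<Longrightarrow> J \<omega> \<subseteq> K \<omega>"
  using closed_K by (simp add: J_def frontier_subset_closed)

lemma J_nonempty: "\<omega> \<in> codes \<Longrightarrow> J \<omega> \<noteq> {}"
proof -
  assume "\<omega> \<in> codes"
  then have "K \<omega> \<noteq> {}" "bounded (K \<omega>)"
    using v_in_K compact_K compact_imp_bounded by auto
  then show ?thesis
    unfolding J_def by (metis frontier_not_empty not_bounded_UNIV)
qed

text \<open>A connected set that avoids the frontier of another set lies inside or outside it. This
  is applied to K \<tau>, to J \<omega> and to the complement of K \<tau>; the common point v rules
  out that the two sets K are disjoint.\<close>

lemma K_nested:
  assumes \<omega>: "\<omega> \<in> codes" and \<tau>: "\<tau> \<in> codes" and disj: "J \<omega> \<inter> J \<tau> = {}"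
  shows "K \<omega> \<subseteq> interior (K \<tau>) \<or> K \<tau> \<subseteq> interior (K \<omega>)"
proof -
  have fr: "J \<sigma> = K \<sigma> - interior (K \<sigma>)" if "\<sigma> \<in> codes" for \<sigma>
    using closed_K[OF that] by (simp add: J_def frontier_def)
  show ?thesis
  proof (cases "J \<omega> \<inter> K \<tau> = {}")
    case True
    have "K \<tau> \<inter> K \<omega> \<noteq> {}"
      using v_in_K \<omega> \<tau> by blast
    then have "K \<tau> - K \<omega> = {}"
      using connected_Int_frontier[OF connected_K[OF \<tau>], of "K \<omega>"] True unfolding J_def by blast
    then have "K \<tau> \<subseteq> interior (K \<omega>)"
      using True fr[OF \<omega>] by blast
    then show ?thesis by blast
  next
    case False
    have "J \<omega> - K \<tau> = {}"
      using connected_Int_frontier[OF connected_J[OF \<omega>], of "K \<tau>"] False disj unfolding J_def by blast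
    then have sub: "J \<omega> \<subseteq> interior (K \<tau>)"
      using disj fr[OF \<tau>] by blast
    \<comment> \<open>If the connected complement of K \<tau>, which misses J \<omega>, met K
      \<omega>, it would lie in K \<omega> and the plane would be bounded.\<close>
    have "\<not> K \<omega> \<inter> - K \<tau> \<noteq> {}"
    proof
      assume "K \<omega> \<inter> - K \<tau> \<noteq> {}"
      moreover have "- K \<tau> \<inter> frontier (K \<omega>) = {}"
        using sub interior_subset[of "K \<tau>"] by (auto simp: J_def)
      ultimately have "- K \<tau> \<subseteq> K \<omega>"
        using connected_Int_frontier[OF connected_Compl_K[OF \<tau>], of "K \<omega>"] by blast
      then have "UNIV \<subseteq> K \<tau> \<union> K \<omega>"
        by blast
      moreover have "bounded (K \<tau> \<union> K \<omega>)"
        using compact_K \<omega> \<tau> by (simp add: compact_imp_bounded)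
      ultimately have "bounded (UNIV :: complex set)"
        by (rule bounded_subset[rotated])
      then show False by simp
    qed
    then have "K \<omega> \<subseteq> K \<tau>"
      by blast
    then have "interior (K \<omega>) \<subseteq> interior (K \<tau>)"
      by (rule interior_mono)
    then have "K \<omega> \<subseteq> interior (K \<tau>)"
      using sub fr[OF \<omega>] by blast
    then show ?thesis by blast
  qed
qed

text \<open>Nested compactness for the sublevel sets at R; passing to the next index allows the
  larger level 2R.\<close>

lemma K_approximation:
  assumes "\<omega> \<in> codes" "open U" "K \<omega> \<subseteq> U"
  shows "\<exists>n. {z. cmod (poly (iter \<omega> n) z) \<le> 2 * R} \<subseteq> U"
proof (rule ccontr)
  define C where "C = (\<lambda>n. {z. cmod (poly (iter \<omega> n) z) \<le> R} - U)"
  assume no: "\<not> ?thesis"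
  have "\<Inter> (range C) \<noteq> {}"
  proof (rule compact_nest)
    show "compact (C n)" for n
      unfolding C_def using compact_poly_sublevel[OF degree_iter_ge_1[OF assms(1)]] assms(2)
      by (rule compact_diff)
    show "C n \<noteq> {}" for n
    proof -
      obtain z where "z \<notin> U" "cmod (poly (iter \<omega> (Suc n)) z) \<le> 2 * R"
        using no by blast
      then show ?thesis
        using iter_Suc_small[OF assms(1)] by (auto simp: C_def)
    qed
    show "C n \<subseteq> C m" if "m \<le> n" for m n
      using iter_sublevel_antimono[OF assms(1) that] by (auto simp: C_def)
  qed
  moreover have "\<Inter> (range C) \<subseteq> K \<omega> - U"
    by (auto simp: C_def K_def)
  ultimately show False
    using assms(3) by blast
qed

text \<open>The logarithm of the leading coefficient is -d x, with d the degree, up to an error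
  bounded independently of n.\<close>

lemma ln_lead_coeff_iter:
  assumes "\<omega> \<in> codes" "coded \<omega> x"
  shows "\<alpha> \<le> real (degree (iter \<omega> n)) * x + ln (cmod (lead_coeff (iter \<omega> n)))"
    and "real (degree (iter \<omega> n)) * x + ln (cmod (lead_coeff (iter \<omega> n))) \<le> ln R"
    and "cmod (lead_coeff (iter \<omega> n)) > 0"
proof -
  have "Psi (iter \<omega> n) x \<in> {\<alpha>..\<beta>}"
    using assms(2) by (simp add: coded_def)
  then show "\<alpha> \<le> real (degree (iter \<omega> n)) * x + ln (cmod (lead_coeff (iter \<omega> n)))"
    "real (degree (iter \<omega> n)) * x + ln (cmod (lead_coeff (iter \<omega> n))) \<le> ln R"
    using \<beta>_le by (auto simp: Psi_def)
  show "cmod (lead_coeff (iter \<omega> n)) > 0"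
    using degree_iter_ge_1[OF assms(1), of n] by auto
qed

text \<open>A fixed lemniscate of \<omega> at level 2R lies in K \<tau>, hence in every lemniscate
  of \<tau> at level R. Comparing leading coefficients bounds the degrees along \<tau>, which are
  unbounded.\<close>

lemma K_not_nested:
  assumes \<omega>: "\<omega> \<in> codes" "coded \<omega> x" and \<tau>: "\<tau> \<in> codes" "coded \<tau> x"
  shows "\<not> K \<omega> \<subseteq> interior (K \<tau>)"
proof
  assume "K \<omega> \<subseteq> interior (K \<tau>)"
  then obtain n where n: "{z. cmod (poly (iter \<omega> n) z) \<le> 2 * R} \<subseteq> interior (K \<tau>)"
    using K_approximation[OF \<omega>(1)] by blast
  define d a where "d = degree (iter \<omega> n)" and "a = cmod (lead_coeff (iter \<omega> n))"
  note a = ln_lead_coeff_iter[OF \<omega>, of n, folded d_def a_def]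
  have bound: "real k \<le> real d * (ln R - \<alpha>) / ln 2" for k
  proof -
    define e b where "e = degree (iter \<tau> k)" and "b = cmod (lead_coeff (iter \<tau> k))"
    note b = ln_lead_coeff_iter[OF \<tau>, of k, folded e_def b_def]
    have "b ^ d * (2 * R) ^ e \<le> R ^ d * a ^ e"
      unfolding d_def a_def b_def e_def
    proof (rule lead_coeff_comparison)
      fix z assume "cmod (poly (iter \<omega> n) z) = 2 * R"
      then have "z \<in> K \<tau>"
        using subsetD[OF n, of z] interior_subset[of "K \<tau>"] by auto
      then show "cmod (poly (iter \<tau> k) z) \<le> R"
        by (simp add: K_def)
    qed (use degree_iter_ge_1[OF \<omega>(1)] R_pos in auto)
    then have "ln (b ^ d * (2 * R) ^ e) \<le> ln (R ^ d * a ^ e)"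
      using a b R_pos by (subst ln_le_cancel_iff) auto
    then have "d * ln b + e * (ln 2 + ln R) \<le> d * ln R + e * ln a"
      using a(3) b(3) R_pos by (simp add: ln_mult ln_realpow distrib_left)
    moreover have "real d * (\<alpha> - e * x) \<le> d * ln b"
      using b(1) by (intro mult_left_mono) (linarith, simp)
    moreover have "real e * ln a \<le> e * (ln R - d * x)"
      using a(2) by (intro mult_left_mono) (linarith, simp)
    \<comment> \<open>The terms d e x cancel because both codes carry the same x, and so does e ln
      R; on the left only the factor 2 of 2R survives.\<close>
    ultimately have le: "real e * ln 2 \<le> real d * (ln R - \<alpha>)"
      by (simp add: algebra_simps)
    have "real k \<le> real e"
      using degree_iter[OF \<tau>(1), of k] less_exp[of k] unfolding e_def by linarith
    then have "real k * ln 2 \<le> real e * ln 2"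
      by (intro mult_right_mono) auto
    then have "real k * ln 2 \<le> real d * (ln R - \<alpha>)"
      using le by (rule order_trans)
    then show ?thesis
      by (simp add: pos_le_divide_eq)
  qed
  obtain k :: nat where "real d * (ln R - \<alpha>) / ln 2 < real k"
    using reals_Archimedean2 by blast
  with bound[of k] show False
    by simp
qed

lemma J_meet:
  assumes "\<omega> \<in> codes" "coded \<omega> x" "\<tau> \<in> codes" "coded \<tau> x"
  shows "J \<omega> \<inter> J \<tau> \<noteq> {}"
  using K_nested[of \<omega> \<tau>] K_not_nested[of \<omega> x \<tau>] K_not_nested[of \<tau> x \<omega>] assms by blast

section \<open>Coding the points of the interval\<close>

lemma Psi_iter_Suc:
  assumes "\<omega> \<in> codes"
  shows "Psi (iter \<omega> (Suc n)) x = Psi (h (\<omega> n)) (Psi (iter \<omega> n) x)"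
proof -
  have "h (\<omega> n) \<noteq> 0"
    using assms degree_h[of "\<omega> n"] by (auto simp: codes_def)
  then show ?thesis
    unfolding iter_Suc by (intro Psi_pcompose degree_iter_ge_1[OF assms])
qed

text \<open>An itinerary: at each point of the orbit \<open>Psi_covers\<close> offers a letter that
  keeps the next point in the interval.\<close>

lemma exists_code:
  assumes "x \<in> {\<alpha>..\<beta>}"
  shows "\<exists>\<omega>\<in>codes. coded \<omega> x"
proof -
  obtain c where c: "\<And>y. y \<in> {\<alpha>..\<beta>} \<Longrightarrow> c y \<in> I \<and> Psi (h (c y)) y \<in> {\<alpha>..\<beta>}"
    using Psi_covers by metis
  define X where "X = rec_nat x (\<lambda>_ y. Psi (h (c y)) y)"
  have X: "X n \<in> {\<alpha>..\<beta>}" for n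
    using assms c by (induction n) (auto simp: X_def simp del: atLeastAtMost_iff)
  define \<omega> where "\<omega> = (\<lambda>n. c (X n))"
  have \<omega>: "\<omega> \<in> codes"
    using c X by (simp add: codes_def \<omega>_def)
  have "Psi (iter \<omega> n) x = X n" for n
    by (induction n) (simp_all add: Psi_iter_Suc[OF \<omega>], simp_all add: iter_0 Psi_def X_def \<omega>_def)
  then have "coded \<omega> x"
    using X by (simp add: coded_def)
  with \<omega> show ?thesis by blast
qed

text \<open>The preimages of [\<alpha>, \<beta>] under the increasing affine maps
  \<open>Psi (iter \<omega> n)\<close> are nonempty compact intervals, and
  \<open>Psi_reflects\<close> makes them decrease.\<close>

lemma exists_coded_value:
  assumes "\<omega> \<in> codes"
  shows "\<exists>x. coded \<omega> x"
proof -
  define C where "C = (\<lambda>n. {x. Psi (iter \<omega> n) x \<in> {\<alpha>..\<beta>}})"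
  have decr: "C (Suc n) \<subseteq> C n" for n
    using assms Psi_reflects by (auto simp: C_def Psi_iter_Suc codes_def simp del: atLeastAtMost_iff)
  have "\<Inter> (range C) \<noteq> {}"
  proof (rule compact_nest)
    fix n
    define d a where "d = real (degree (iter \<omega> n))" and "a = ln (cmod (lead_coeff (iter \<omega> n)))"
    have d: "d > 0"
      using degree_iter_ge_1[OF assms, of n] by (simp add: d_def)
    have "C n = {(\<alpha> - a) / d..(\<beta> - a) / d}"
      using d by (auto simp: C_def Psi_def d_def[symmetric] a_def[symmetric] field_simps)
    then show "compact (C n)" "C n \<noteq> {}"
      using \<alpha>_le_\<beta> d by (auto simp: divide_right_mono)
  next
    fix m n :: nat assume "m \<le> n"
    then show "C n \<subseteq> C m"
      using lift_Suc_antimono_le[of C, OF decr] by blast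
  qed
  then show ?thesis
    by (auto simp: C_def coded_def)
qed

lemma coded_bounds: "coded \<omega> x \<Longrightarrow> x \<in> {\<alpha>..\<beta>}"
  unfolding coded_def by (drule spec[of _ 0]) (simp add: iter_0 Psi_def)

text \<open>By \<open>lead_coeff_comparison\<close>, a set of capacity at least \<open>exp \<alpha>\<close> lies in no smaller disc.\<close>
lemma K_spread:
  assumes \<omega>: "\<omega> \<in> codes"
  shows "\<exists>b\<in>K \<omega>. exp \<alpha> \<le> dist v b"
proof (rule ccontr)
  assume "\<not> ?thesis"
  then have "K \<omega> \<subseteq> ball v (exp \<alpha>)"
    by auto
  then obtain n where n: "{z. cmod (poly (iter \<omega> n) z) \<le> 2 * R} \<subseteq> ball v (exp \<alpha>)"
    using K_approximation[OF \<omega>] by blast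
  obtain x where x: "coded \<omega> x"
    using exists_coded_value[OF \<omega>] by blast
  define d a where "d = degree (iter \<omega> n)" and "a = cmod (lead_coeff (iter \<omega> n))"
  note a = ln_lead_coeff_iter[OF \<omega> x, of n, folded d_def a_def]
  \<comment> \<open>The second polynomial is z - v, of degree 1. The outcome 2R \<le>
    exp(\<alpha>)^d a contradicts d x + ln a \<le> ln R, since \<alpha> \<le> x.\<close>
  have "cmod (lead_coeff [:- v, 1:]) ^ d * (2 * R) ^ degree [:- v, 1:] \<le> exp \<alpha> ^ d * a ^ degree [:- v, 1:]"
    unfolding d_def a_def
  proof (rule lead_coeff_comparison)
    fix z assume "cmod (poly (iter \<omega> n) z) = 2 * R"
    then have "z \<in> ball v (exp \<alpha>)"
      by (intro subsetD[OF n]) simp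
    then show "cmod (poly [:- v, 1:] z) \<le> exp \<alpha>"
      by (simp add: dist_norm norm_minus_commute)
  qed (use degree_iter_ge_1[OF \<omega>] R_pos in auto)
  then have "2 * R \<le> exp \<alpha> ^ d * a"
    by simp
  then have "ln (2 * R) \<le> ln (exp \<alpha> ^ d * a)"
    using R_pos a by (subst ln_le_cancel_iff) auto
  then have "ln 2 + ln R \<le> d * \<alpha> + ln a"
    using R_pos a(3) by (simp add: ln_mult ln_realpow)
  moreover have "real d * \<alpha> \<le> d * x"
    using coded_bounds[OF x] by (intro mult_left_mono) auto
  moreover have "ln (2 :: real) > 0"
    by simp
  ultimately show False
    using a(2) by linarith
qed

lemma iter_escape:
  assumes "\<omega> \<in> codes" "cmod (poly (iter \<omega> n) z) > R"
  shows "cmod (poly (iter \<omega> (n + k)) z) \<ge> 2 ^ k * R"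
proof -
  have "2 ^ k * cmod (poly (iter \<omega> n) z) \<le> cmod (poly (iter \<omega> (n + k)) z)"
    using word_poly_escape[OF codes_word[OF codes_shift[OF assms(1)]], of "poly (iter \<omega> n) z" n k] assms(2)
    by (simp add: iter_add poly_pcompose flip: iter_def)
  moreover have "2 ^ k * R \<le> 2 ^ k * cmod (poly (iter \<omega> n) z)"
    using assms(2) by (intro mult_left_mono) auto
  ultimately show ?thesis by linarith
qed

lemma ball_K_dichotomy:
  assumes "\<omega> \<in> codes" "J \<omega> \<inter> ball z e = {}"
  shows "ball z e \<subseteq> K \<omega> \<or> ball z e \<inter> K \<omega> = {}"
  using connected_Int_frontier[OF connected_ball, of z e "K \<omega>"] assms(2) unfolding J_def by blast

text \<open>
  If \<open>J \<tau>\<close> misses the disc, then the iterates along \<open>\<tau>\<close> omit there two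
  values at distance at least \<open>exp \<alpha>\<close>, so by Schottky they cannot be bounded at \<open>z\<close> and huge
  at a nearby point.
\<close>
lemma J_lower_semicontinuous:
  assumes \<omega>: "\<omega> \<in> codes" and z: "z \<in> J \<omega>" and e: "e > 0"
  shows "\<exists>N. \<forall>\<tau>\<in>codes. (\<forall>i<N. \<tau> i = \<omega> i) \<longrightarrow> J \<tau> \<inter> ball z e \<noteq> {}"
proof -
  \<comment> \<open>An escaping point within e/2, so that the Schottky bound on the half ball
    reaches it.\<close>
  obtain y where y: "y \<notin> K \<omega>" "dist z y < e / 2"
    using z e unfolding J_def frontier_straddle by (meson half_gt_zero)
  then obtain n where n: "cmod (poly (iter \<omega> n) y) > R"
    by (auto simp: K_def not_le)
  \<comment> \<open>Bounds the normalized value at z: the numerator is at most R + |v|, and the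
    omitted values v and b differ by at least exp \<alpha>. It is independent of \<tau>, so k can be
    chosen uniformly.\<close>
  define r where "r = (R + cmod v) / exp \<alpha>"
  define B where "B = exp (pi * exp (pi * (26 + 2 * r)))"
  obtain k where "(cmod v + B * (2 * R)) / R < 2 ^ k"
    using real_arch_pow[of 2] by auto
  then have k: "cmod v + B * (2 * R) < 2 ^ k * R"
    using R_pos by (simp add: divide_less_eq)
  have "J \<tau> \<inter> ball z e \<noteq> {}" if \<tau>: "\<tau> \<in> codes" and agree: "\<forall>i<n + k. \<tau> i = \<omega> i" for \<tau>
  proof
    assume disj: "J \<tau> \<inter> ball z e = {}"
    define p where "p = iter \<omega> (n + k)"
    have p: "p = iter \<tau> (n + k)" and "iter \<omega> n = iter \<tau> n"
      unfolding p_def using agree by (auto intro!: iter_cong)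
    then have "y \<notin> K \<tau>"
      using n by (auto simp: K_def not_le intro!: exI[of _ n])
    moreover have "y \<in> ball z e"
      using y e by auto
    ultimately have out: "ball z e \<inter> K \<tau> = {}"
      using ball_K_dichotomy[OF \<tau> disj] by blast
    \<comment> \<open>The tail of \<tau> after the common prefix. As the ball misses K \<tau>, its
      image under p misses K \<sigma>, in particular v and b.\<close>
    define \<sigma> where "\<sigma> = (\<lambda>i. \<tau> (n + k + i))"
    have \<sigma>: "\<sigma> \<in> codes"
      unfolding \<sigma>_def by (rule codes_shift[OF \<tau>])
    obtain b where b: "b \<in> K \<sigma>" "exp \<alpha> \<le> dist v b"
      using K_spread[OF \<sigma>] by blast
    have omit: "poly p w \<notin> K \<sigma>" if "w \<in> ball z e" for w
      using out that K_shift[OF \<tau>, of w "n + k"] by (auto simp: p \<sigma>_def)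
    have bv: "exp \<alpha> \<le> cmod (b - v)" "b \<noteq> v" "cmod (b - v) \<le> 2 * R"
    proof -
      show "exp \<alpha> \<le> cmod (b - v)"
        using b by (simp add: dist_norm norm_minus_commute)
      then show "b \<noteq> v"
        using exp_gt_zero[of \<alpha>] by (auto simp del: exp_gt_zero)
      have "cmod b \<le> R" "cmod v \<le> R"
        using b(1) v_in_K[OF \<sigma>] K_subset[of \<sigma>] by auto
      then show "cmod (b - v) \<le> 2 * R"
        using norm_triangle_ineq4[of b v] by linarith
    qed
    have "z \<in> K \<omega>"
      using z J_subset_K[OF \<omega>] by blast
    then have pz: "cmod (poly p z) \<le> R"
      by (simp add: K_def p_def)
    have "cmod ((poly p y - v) / (b - v)) \<le> B"
      unfolding B_def
    proof (rule Schottky_ball[where f = "\<lambda>w. (poly p w - v) / (b - v)"])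
      show "(\<lambda>w. (poly p w - v) / (b - v)) holomorphic_on ball z e"
        using bv(2) by (intro holomorphic_intros) auto
      show "(poly p w - v) / (b - v) \<noteq> 0 \<and> (poly p w - v) / (b - v) \<noteq> 1" if "w \<in> ball z e" for w
        using omit[OF that] b(1) v_in_K[OF \<sigma>] bv(2) by auto
      have "cmod (poly p z - v) \<le> R + cmod v"
        using pz norm_triangle_ineq4[of "poly p z" v] by linarith
      then show "cmod ((poly p z - v) / (b - v)) \<le> r"
        unfolding r_def norm_divide using bv(1) R_pos by (intro frac_le) auto
      show "y \<in> cball z (e / 2)"
        using y(2) by simp
    qed (fact e)
    then have "cmod (poly p y - v) \<le> B * cmod (b - v)"
      using bv(2) by (simp add: norm_divide divide_le_eq)
    also have "\<dots> \<le> B * (2 * R)"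
      using bv(3) by (intro mult_left_mono) (auto simp: B_def)
    finally have "cmod (poly p y) \<le> cmod v + B * (2 * R)"
      using norm_triangle_ineq2[of "poly p y" v] by linarith
    moreover have "2 ^ k * R \<le> cmod (poly p y)"
      unfolding p_def by (rule iter_escape[OF \<omega> n])
    ultimately show False
      using k by linarith
  qed
  then show ?thesis
    by (intro exI[of _ "n + k"]) blast
qed

text \<open>A countable power of a finite set is compact, and convergence in it means eventual
  agreement on every prefix.\<close>

lemma codes_convergent_subsequence:
  fixes W :: "nat \<Rightarrow> nat \<Rightarrow> nat"
  assumes "\<And>k. W k \<in> codes"
  shows "\<exists>\<tau>\<in>codes. \<exists>r. strict_mono r \<and> (\<forall>N. \<forall>\<^sub>F k in sequentially. \<forall>i<N. W (r k) i = \<tau> i)"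
proof -
  have "codes = PiE UNIV (\<lambda>_. I)"
    by (auto simp: codes_def)
  then have "compactin (product_topology (\<lambda>_. euclidean) UNIV) codes"
    using finite_I by (simp add: compactin_PiE finite_imp_compact)
  then have "seq_compact codes"
    by (simp add: euclidean_product_topology compact_imp_seq_compact)
  then obtain \<tau> r where \<tau>: "\<tau> \<in> codes" "strict_mono r" "(W \<circ> r) \<longlonglongrightarrow> \<tau>"
    using assms unfolding seq_compact_def by blast
  have "\<forall>\<^sub>F k in sequentially. W (r k) i = \<tau> i" for i
  proof -
    have "(\<lambda>k. (W \<circ> r) k i) \<longlonglongrightarrow> \<tau> i"
      using continuous_on_tendsto_compose[OF continuous_on_product_coordinates[of i] \<tau>(3)] by simp
    then show ?thesis
      by (simp add: tendsto_discrete)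
  qed
  then have "\<forall>\<^sub>F k in sequentially. \<forall>i\<in>{..<N}. W (r k) i = \<tau> i" for N
    by (intro eventually_ball_finite) auto
  then have "\<forall>\<^sub>F k in sequentially. \<forall>i<N. W (r k) i = \<tau> i" for N
    by (simp only: Ball_def lessThan_iff)
  then show ?thesis
    using \<tau> by (intro bexI[of _ \<tau>] exI[of _ r]) simp_all
qed

lemma coded_limit:
  assumes W: "\<And>k. W k \<in> codes" "\<And>k. coded (W k) (X k)"
    and conv: "\<And>N. \<forall>\<^sub>F k in sequentially. \<forall>i<N. W k i = \<tau> i" and X: "X \<longlonglongrightarrow> x"
  shows "coded \<tau> x"
  unfolding coded_def
proof
  fix n
  have "\<forall>\<^sub>F k in sequentially. Psi (iter \<tau> n) (X k) \<in> {\<alpha>..\<beta>}"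
    using conv[of n]
  proof eventually_elim
    case (elim k)
    then have "iter (W k) n = iter \<tau> n"
      by (intro iter_cong) auto
    then show ?case
      using W(2)[of k] unfolding coded_def by (metis (no_types))
  qed
  moreover have "(\<lambda>k. Psi (iter \<tau> n) (X k)) \<longlonglongrightarrow> Psi (iter \<tau> n) x"
    unfolding Psi_def by (intro tendsto_intros X)
  ultimately show "Psi (iter \<tau> n) x \<in> {\<alpha>..\<beta>}"
    by (intro Lim_in_closed_set[of "{\<alpha>..\<beta>}"]) auto
qed

section \<open>Connectedness of the union of the sets J\<close>

definition Q :: "complex set" where
  "Q = (\<Union>\<omega>\<in>codes. J \<omega>)"

text \<open>A limit \<tau> of the codes W codes the limit value. If J \<tau> were in B, lower
  semicontinuity would make some J (W k), which lies in A, meet B.\<close>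

lemma closed_values_of_part:
  assumes AB: "open B" "A \<inter> B \<inter> Q = {}" and dich: "\<And>\<omega>. \<omega> \<in> codes \<Longrightarrow> J \<omega> \<subseteq> A \<or> J \<omega> \<subseteq> B"
  shows "closed {x. \<exists>\<omega>\<in>codes. coded \<omega> x \<and> J \<omega> \<subseteq> A}"
  unfolding closed_sequential_limits
proof (intro allI impI, elim conjE)
  fix X x assume "\<forall>n. X n \<in> {x. \<exists>\<omega>\<in>codes. coded \<omega> x \<and> J \<omega> \<subseteq> A}" and X: "X \<longlonglongrightarrow> x"
  then have "\<forall>n. \<exists>\<omega>. \<omega> \<in> codes \<and> coded \<omega> (X n) \<and> J \<omega> \<subseteq> A"
    by blast
  then obtain W where W: "\<And>n. W n \<in> codes" "\<And>n. coded (W n) (X n)" "\<And>n. J (W n) \<subseteq> A"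
    by metis
  obtain \<tau> r where \<tau>: "\<tau> \<in> codes" "strict_mono r"
      "\<And>N. \<forall>\<^sub>F k in sequentially. \<forall>i<N. W (r k) i = \<tau> i"
    using codes_convergent_subsequence[of W] W(1) by blast
  have "coded \<tau> x"
    using coded_limit[of "\<lambda>k. W (r k)" "\<lambda>k. X (r k)" \<tau> x] W \<tau> LIMSEQ_subseq_LIMSEQ[OF X \<tau>(2)]
    by (simp add: o_def)
  moreover have "\<not> J \<tau> \<subseteq> B"
  proof
    assume "J \<tau> \<subseteq> B"
    then obtain z where z: "z \<in> J \<tau>" "z \<in> B"
      using J_nonempty[OF \<tau>(1)] by blast
    then obtain e where e: "e > 0" "ball z e \<subseteq> B"
      using AB(1) by (auto elim: openE)
    obtain N where N: "\<And>\<sigma>. \<sigma> \<in> codes \<Longrightarrow> (\<forall>i<N. \<sigma> i = \<tau> i) \<Longrightarrow> J \<sigma> \<inter> ball z e \<noteq> {}"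
      using J_lower_semicontinuous[OF \<tau>(1) z(1) e(1)] by blast
    obtain k where "\<forall>i<N. W (r k) i = \<tau> i"
      using eventually_happens[OF \<tau>(3)[of N]] by auto
    then have "J (W (r k)) \<inter> ball z e \<noteq> {}"
      using N W(1) by blast
    then have "A \<inter> B \<inter> J (W (r k)) \<noteq> {}"
      using W(3)[of "r k"] e(2) by blast
    moreover have "J (W (r k)) \<subseteq> Q"
      using W(1) by (auto simp: Q_def)
    ultimately show False
      using AB(2) by blast
  qed
  ultimately show "x \<in> {x. \<exists>\<omega>\<in>codes. coded \<omega> x \<and> J \<omega> \<subseteq> A}"
    using dich[OF \<tau>(1)] \<tau>(1) by blast
qed

proposition connected_Q: "connected Q"
proof (rule ccontr)
  assume "\<not> connected Q"
  then obtain A B where AB: "open A" "open B" "Q \<subseteq> A \<union> B" "A \<inter> B \<inter> Q = {}" "A \<inter> Q \<noteq> {}" "B \<inter> Q \<noteq> {}"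
    unfolding connected_def by blast
  have JQ: "J \<omega> \<subseteq> Q" if "\<omega> \<in> codes" for \<omega>
    using that by (auto simp: Q_def)
  have dich: "J \<omega> \<subseteq> A \<or> J \<omega> \<subseteq> B" if "\<omega> \<in> codes" for \<omega>
  proof -
    have "A \<inter> J \<omega> = {} \<or> B \<inter> J \<omega> = {}"
      using JQ[OF that] AB by (intro connectedD[OF connected_J[OF that]]) blast+
    then show ?thesis
      using JQ[OF that] AB(3) by blast
  qed
  define CA where "CA = {x. \<exists>\<omega>\<in>codes. coded \<omega> x \<and> J \<omega> \<subseteq> A}"
  define CB where "CB = {x. \<exists>\<omega>\<in>codes. coded \<omega> x \<and> J \<omega> \<subseteq> B}"
  have "closed CA"
    unfolding CA_def using AB dich by (intro closed_values_of_part[of B A]) auto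
  moreover have "closed CB"
    unfolding CB_def using AB dich by (intro closed_values_of_part[of A B]) blast+
  moreover have "{\<alpha>..\<beta>} \<subseteq> CA \<union> CB"
    using exists_code dich by (force simp: CA_def CB_def)
  \<comment> \<open>Two codes of the same number have intersecting sets J, which cannot lie on
    different sides.\<close>
  moreover have "CA \<inter> CB \<inter> {\<alpha>..\<beta>} = {}"
  proof -
    have False if *: "\<omega> \<in> codes" "coded \<omega> x" "J \<omega> \<subseteq> A" "\<tau> \<in> codes" "coded \<tau> x" "J \<tau> \<subseteq> B" for x \<omega> \<tau>
      using J_meet[OF *(1,2,4,5)] JQ[OF *(1)] AB(4) *(3,6) by blast
    then show ?thesis
      by (auto simp: CA_def CB_def)
  qed
  moreover have "CA \<inter> {\<alpha>..\<beta>} \<noteq> {}"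
  proof -
    obtain \<omega> where \<omega>: "\<omega> \<in> codes" "A \<inter> J \<omega> \<noteq> {}"
      using AB(5) by (auto simp: Q_def)
    then have "J \<omega> \<subseteq> A"
      using dich[OF \<omega>(1)] JQ[OF \<omega>(1)] AB(4) by blast
    then show ?thesis
      using exists_coded_value[OF \<omega>(1)] coded_bounds \<omega>(1) unfolding CA_def by blast
  qed
  moreover have "CB \<inter> {\<alpha>..\<beta>} \<noteq> {}"
  proof -
    obtain \<omega> where \<omega>: "\<omega> \<in> codes" "B \<inter> J \<omega> \<noteq> {}"
      using AB(6) by (auto simp: Q_def)
    then have "J \<omega> \<subseteq> B"
      using dich[OF \<omega>(1)] JQ[OF \<omega>(1)] AB(4) by blast
    then show ?thesis
      using exists_coded_value[OF \<omega>(1)] coded_bounds \<omega>(1) unfolding CB_def by blast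
  qed
  ultimately show False
    using connected_Icc[of \<alpha> \<beta>] unfolding connected_closed by blast
qed

section \<open>The Julia set between Q and its closure\<close>

definition word_polys :: "complex poly set" where
  "word_polys = {word_poly h w |w. w \<noteq> [] \<and> set w \<subseteq> I}"

lemma iter_Suc_in_word_polys: "\<omega> \<in> codes \<Longrightarrow> iter \<omega> (Suc n) \<in> word_polys"
  unfolding word_polys_def iter_def using codes_word[of \<omega> "Suc n"]
  by (intro CollectI exI[of _ "map \<omega> [0..<Suc n]"]) auto

text \<open>Arbitrarily close to z there are escaping points, where a chordal limit is infinity. By
  continuity it is infinity at z, although the orbit of z stays in the disc of radius R.\<close>

lemma J_subset_julia:
  assumes \<omega>: "\<omega> \<in> codes" and z: "z \<in> J \<omega>"
  shows "Some z \<in> julia_set (sphere_poly ` word_polys)"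
proof (rule ccontr)
  assume "\<not> ?thesis"
  then obtain U where U: "openin riemann_sphere U" "Some z \<in> U"
      "normal_family_on U (sphere_poly ` word_polys)"
    by (auto simp: julia_set_def fatou_set_def)
  have "openin euclidean {w \<in> topspace euclidean. Some w \<in> U}"
    using U(1) unfolding riemann_sphere_def by (rule openin_continuous_map_preimage[OF continuous_map_Some])
  then have "open {w. Some w \<in> U}"
    by simp
  then obtain e where e: "e > 0" "cball z e \<subseteq> {w. Some w \<in> U}"
    using U(2) by (auto simp: open_contains_cball)
  \<comment> \<open>\<open>Suc\<close> because the empty word is excluded from
    \<open>word_polys\<close>.\<close>
  define p where "p = (\<lambda>n. iter \<omega> (Suc n))"
  have rng: "range (\<lambda>n. sphere_poly (p n)) \<subseteq> sphere_poly ` word_polys"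
    using iter_Suc_in_word_polys[OF \<omega>] by (auto simp: p_def)
  obtain r l where rl: "strict_mono (r :: nat \<Rightarrow> nat)"
      "\<And>C. compactin riemann_sphere C \<Longrightarrow> C \<subseteq> U \<Longrightarrow>
        uniform_limit C (\<lambda>n. stereo \<circ> sphere_poly (p (r n))) (stereo \<circ> l) sequentially"
    using U(3)[unfolded normal_family_on_def, rule_format, OF rng] by blast
  define L where "L = (\<lambda>w. stereo (l (Some w)))"
  have "uniform_limit (Some ` cball z e) (\<lambda>n. stereo \<circ> sphere_poly (p (r n))) (stereo \<circ> l) sequentially"
    using e(2) by (intro rl(2)) (auto simp: compactin_Some_image_iff)
  then have lim: "uniform_limit (cball z e) (\<lambda>n w. stereo (Some (poly (p (r n)) w))) L sequentially"
    by (simp add: uniform_limit_iff L_def sphere_poly_def)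
  have point: "(\<lambda>n. stereo (Some (poly (p (r n)) w))) \<longlonglongrightarrow> L w" if "w \<in> cball z e" for w
    using tendsto_uniform_limitI[OF lim that] .
  have "continuous_on UNIV (\<lambda>w. stereo (Some (poly (p n) w)))" for n
  proof -
    have "continuous_on UNIV (poly (p n))"
      by (intro continuous_intros)
    from continuous_on_compose2[OF continuous_on_stereo_Some this] show ?thesis
      by simp
  qed
  then have "continuous_on (cball z e) (\<lambda>w. stereo (Some (poly (p n) w)))" for n
    by (rule continuous_on_subset) simp
  then have "continuous_on (cball z e) L"
    by (intro uniform_limit_theorem[OF _ lim]) auto
  then have "closedin (top_of_set (cball z e)) {w \<in> cball z e. L w = stereo None}"
    by (rule continuous_closedin_preimage_constant)
  then have cl: "closed {w \<in> cball z e. L w = stereo None}"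
    by (rule closedin_closed_trans[OF _ closed_cball])
  have inf: "L w = stereo None" if w: "w \<in> cball z e" "w \<notin> K \<omega>" for w
  proof -
    obtain N where N: "cmod (poly (iter \<omega> N) w) > R"
      using w(2) by (auto simp: K_def not_le)
    \<comment> \<open>As n \<le> r n, at least n - N doublings follow the time N.\<close>
    have bound: "dist (stereo (Some (poly (p (r n)) w))) (stereo None) \<le> 2 / (2 ^ (n - N) * R)" if "n \<ge> N" for n
    proof (rule dist_stereo_infinity_le)
      have "Suc (r n) = N + (Suc (r n) - N)" "n - N \<le> Suc (r n) - N"
        using seq_suble[OF rl(1), of n] that by auto
      then have "2 ^ (Suc (r n) - N) * R \<le> cmod (poly (p (r n)) w)" "(2 :: real) ^ (n - N) \<le> 2 ^ (Suc (r n) - N)"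
        using iter_escape[OF \<omega> N, of "Suc (r n) - N"] unfolding p_def by (auto simp del: iter_Suc)
      then show "2 ^ (n - N) * R \<le> cmod (poly (p (r n)) w)"
        using R_pos by (meson mult_right_mono less_imp_le order_trans)
    qed (use R_pos in auto)
    have "(\<lambda>n. 2 / R * (1 / 2) ^ n) \<longlonglongrightarrow> 2 / R * 0"
      by (intro tendsto_intros LIMSEQ_power_zero) auto
    then have "(\<lambda>n. 2 / (2 ^ n * R)) \<longlonglongrightarrow> 0"
      by (simp add: power_divide mult_ac)
    then have "(\<lambda>n. 2 / (2 ^ (n + N - N) * R)) \<longlonglongrightarrow> 0"
      by simp
    then have "(\<lambda>n. 2 / (2 ^ (n - N) * R)) \<longlonglongrightarrow> 0"
      by (rule LIMSEQ_offset)
    then have "(\<lambda>n. dist (stereo (Some (poly (p (r n)) w))) (stereo None)) \<longlonglongrightarrow> 0"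
      by (rule Lim_null_comparison[rotated])
        (use bound in \<open>auto simp: eventually_sequentially intro!: exI[of _ N]\<close>)
    then have "(\<lambda>n. stereo (Some (poly (p (r n)) w))) \<longlonglongrightarrow> stereo None"
      by (rule tendsto_dist_iff[THEN iffD2])
    then show ?thesis
      using LIMSEQ_unique[OF point[OF w(1)]] by blast
  qed
  have "z \<in> closure ({w \<in> cball z e. L w = stereo None})"
    unfolding closure_approachable
  proof (intro allI impI)
    fix d :: real assume "d > 0"
    then obtain y where "y \<notin> K \<omega>" "dist z y < min d e"
      using z e(1) unfolding J_def frontier_straddle by (meson min_less_iff_conj)
    then show "\<exists>y\<in>{w \<in> cball z e. L w = stereo None}. dist y z < d"
      using inf by (intro bexI[of _ y]) (auto simp: dist_commute)
  qed
  then have Lz: "L z = stereo None"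
    using cl by simp
  have "closed ((\<lambda>w. stereo (Some w)) ` cball 0 R)"
    by (intro compact_imp_closed compact_continuous_image continuous_on_subset[OF continuous_on_stereo_Some]) auto
  moreover have "stereo (Some (poly (p (r n)) z)) \<in> (\<lambda>w. stereo (Some w)) ` cball 0 R" for n
    using z J_subset_K[OF \<omega>] by (auto simp: K_def p_def)
  ultimately have "L z \<in> (\<lambda>w. stereo (Some w)) ` cball 0 R"
    using point[of z] e(1) by (intro Lim_in_closed_set[where F = sequentially]) auto
  then show False
    using Lz stereo_inj by (auto dest: injD)
qed

text \<open>This places the Julia set in the plane. If the word lengths are bounded along a
  subsequence, one word recurs since the alphabet is finite; otherwise the maps tend to infinity
  uniformly on U.\<close>

lemma infinity_in_fatou: "None \<in> fatou_set (sphere_poly ` word_polys)"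
proof -
  define U where "U = insert None (Some ` (UNIV - cball (0 :: complex) R))"
  have "openin riemann_sphere U"
    unfolding riemann_sphere_def openin_Alexandroff_compactification U_def
    by (intro disjI2 exI[of _ "cball 0 R"]) auto
  moreover have "normal_family_on U (sphere_poly ` word_polys)"
    unfolding normal_family_on_def
  proof (intro allI impI)
    fix f :: "nat \<Rightarrow> complex option \<Rightarrow> complex option"
    assume "range f \<subseteq> sphere_poly ` word_polys"
    then have "\<forall>n. \<exists>w. set w \<subseteq> I \<and> f n = sphere_poly (word_poly h w)"
      unfolding word_polys_def by blast
    then obtain w where w: "\<And>n. set (w n) \<subseteq> I" "\<And>n. f n = sphere_poly (word_poly h (w n))"
      by metis
    show "\<exists>r. strict_mono r \<and> (\<exists>l. \<forall>C. compactin riemann_sphere C \<and> C \<subseteq> U \<longrightarrow>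
      uniform_limit C (\<lambda>n. stereo \<circ> f (r n)) (stereo \<circ> l) sequentially)"
    proof (cases "\<exists>b. infinite {n. length (w n) \<le> b}")
      case True
      then obtain b where b: "infinite {n. length (w n) \<le> b}"
        by blast
      have "finite {u. set u \<subseteq> I \<and> length u \<le> b}"
        by (rule finite_lists_length_le[OF finite_I])
      moreover have "w ` {n. length (w n) \<le> b} \<subseteq> {u. set u \<subseteq> I \<and> length u \<le> b}"
        using w(1) by auto
      ultimately obtain n0 where "infinite {n \<in> {n. length (w n) \<le> b}. w n = w n0}"
        using pigeonhole_infinite[OF b] finite_subset by blast
      then obtain r :: "nat \<Rightarrow> nat" where "strict_mono r" "\<And>n. w (r n) = w n0"
        using infinite_enumerate[of "{n \<in> {n. length (w n) \<le> b}. w n = w n0}"] by auto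
      then show ?thesis
        by (intro exI[of _ r] conjI exI[of _ "f n0"]) (auto simp: w(2) uniform_limit_iff)
    next
      case False
      have "uniform_limit U (\<lambda>n. stereo \<circ> f (id n)) (stereo \<circ> (\<lambda>_. None)) sequentially"
      proof (rule uniform_limitI)
        fix e :: real assume "e > 0"
        obtain k where "2 / R / e < 2 ^ k"
          using real_arch_pow[of 2] by auto
        then have k: "2 / (2 ^ k * R) < e"
          using \<open>e > 0\<close> R_pos by (simp add: field_simps)
        have "\<forall>\<^sub>F n in sequentially. \<not> length (w n) \<le> k"
          using False unfolding eventually_cofinite cofinite_eq_sequentially[symmetric] by simp
        then show "\<forall>\<^sub>F n in sequentially. \<forall>x\<in>U. dist ((stereo \<circ> f (id n)) x) ((stereo \<circ> (\<lambda>_. None)) x) < e"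
        proof eventually_elim
          case (elim n)
          have "dist (stereo (Some (poly (word_poly h (w n)) z))) (stereo None) < e" if z: "R < cmod z" for z
          proof -
            have "2 ^ k * R \<le> 2 ^ length (w n) * cmod z"
              using elim z R_pos by (intro mult_mono power_increasing) auto
            also have "\<dots> \<le> cmod (poly (word_poly h (w n)) z)"
              using z by (intro word_poly_escape w) auto
            finally have "dist (stereo (Some (poly (word_poly h (w n)) z))) (stereo None) \<le> 2 / (2 ^ k * R)"
              using R_pos by (intro dist_stereo_infinity_le) auto
            with k show ?thesis by linarith
          qed
          then show ?case
            using \<open>e > 0\<close> by (auto simp: U_def w(2) sphere_poly_def)
        qed
      qed
      then show ?thesis
        by (intro exI[of _ id] conjI exI[of _ "\<lambda>_. None"] allI impI)
          (auto simp: strict_mono_id intro: uniform_limit_on_subset)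
    qed
  qed
  moreover have "None \<in> U"
    by (simp add: U_def)
  ultimately show ?thesis
    unfolding fatou_set_def by blast
qed

text \<open>On a ball off the closure of Q, each word is either bounded by R or omits two points
  that do not depend on the word; Montel's theorem covers both cases.\<close>

lemma julia_subset_closure_Q:
  assumes "Some z \<in> julia_set (sphere_poly ` word_polys)"
  shows "z \<in> closure Q"
proof (rule ccontr)
  assume "z \<notin> closure Q"
  then have "z \<in> - closure Q" "open (- closure Q)"
    by auto
  then obtain \<rho> where \<rho>: "\<rho> > 0" "ball z \<rho> \<subseteq> - closure Q"
    by (meson openE)
  have "normal_family_on (Some ` ball z (\<rho> / 2)) (sphere_poly ` word_polys)"
  proof (rule normal_family_on_polysI)
    fix p :: "nat \<Rightarrow> complex poly"
    assume "\<And>n. p n \<in> word_polys"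
    then have "\<forall>n. \<exists>w. set w \<subseteq> I \<and> p n = word_poly h w"
      unfolding word_polys_def by blast
    then obtain w where w: "\<And>n. set (w n) \<subseteq> I" "\<And>n. p n = word_poly h (w n)"
      by metis
    obtain j where j: "j \<in> I"
      using I_ne by blast
    \<comment> \<open>Padding all words with the same letter gives them the common tail \<sigma>, so
      the omitted values can be fixed once in K \<sigma>.\<close>
    define \<omega> where "\<omega> = (\<lambda>n i. if i < length (w n) then w n ! i else j)"
    define \<sigma> where "\<sigma> = (\<lambda>i :: nat. j)"
    have \<sigma>: "\<sigma> \<in> codes"
      using j by (simp add: codes_def \<sigma>_def)
    have \<omega>: "\<omega> n \<in> codes" for n
      using j w(1)[of n] by (auto simp: codes_def \<omega>_def dest: nth_mem)
    have p: "p n = iter (\<omega> n) (length (w n))" for n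
    proof -
      have "map (\<omega> n) [0..<length (w n)] = w n"
        by (rule nth_equalityI) (auto simp: \<omega>_def)
      then show ?thesis
        by (simp add: iter_def w(2))
    qed
    have K: "y \<in> K (\<omega> n) \<longleftrightarrow> poly (p n) y \<in> K \<sigma>" for n y
    proof -
      have "(\<lambda>i. \<omega> n (length (w n) + i)) = \<sigma>"
        by (simp add: \<omega>_def \<sigma>_def)
      then show ?thesis
        using K_shift[OF \<omega>, of y n "length (w n)"] by (simp add: p)
    qed
    have dich: "ball z \<rho> \<subseteq> K (\<omega> n) \<or> ball z \<rho> \<inter> K (\<omega> n) = {}" for n
    proof (rule ball_K_dichotomy[OF \<omega>])
      have "J (\<omega> n) \<subseteq> closure Q"
        using \<omega> closure_subset[of Q] unfolding Q_def by blast
      then show "J (\<omega> n) \<inter> ball z \<rho> = {}"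
        using \<rho>(2) by blast
    qed
    show "normal_sequence_on (ball z (\<rho> / 2)) (\<lambda>n. poly (p n))"
    proof (cases "infinite {n. ball z \<rho> \<subseteq> K (\<omega> n)}")
      case True
      then obtain s where s: "strict_mono (s :: nat \<Rightarrow> nat)" "\<And>n. ball z \<rho> \<subseteq> K (\<omega> (s n))"
        using infinite_enumerate[OF True] unfolding mem_Collect_eq by blast
      have "normal_sequence_on (ball z (\<rho> / 2)) (\<lambda>n. poly (p (s n)))"
      proof (rule normal_sequence_on_bounded)
        show "cmod (poly (p (s n)) y) \<le> R" if "y \<in> ball z (\<rho> / 2)" for n y
        proof -
          have "y \<in> K (\<omega> (s n))"
            using s(2)[of n] that \<rho>(1) by auto
          then show ?thesis
            by (simp add: K_def p)
        qed
      qed (auto intro: holomorphic_intros)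
      then show ?thesis
        using normal_sequence_on_subseq[OF s(1), of _ "\<lambda>n. poly (p n)"] by simp
    next
      case False
      then have inf: "infinite (UNIV - {n. ball z \<rho> \<subseteq> K (\<omega> n)})"
        by (intro Diff_infinite_finite) auto
      obtain s where s: "strict_mono (s :: nat \<Rightarrow> nat)" "\<And>n. \<not> ball z \<rho> \<subseteq> K (\<omega> (s n))"
        using infinite_enumerate[OF inf] unfolding Diff_iff mem_Collect_eq by blast
      obtain b where b: "b \<in> K \<sigma>" "exp \<alpha> \<le> dist v b"
        using K_spread[OF \<sigma>] by blast
      have "normal_sequence_on (ball z (\<rho> / 2)) (\<lambda>n. poly (p (s n)))"
      proof (rule normal_sequence_on_omitting[OF _ \<rho>(1)])
        show "v \<noteq> b"
          using b(2) exp_gt_zero[of \<alpha>] by (auto simp del: exp_gt_zero)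
        show "poly (p (s n)) y \<noteq> v \<and> poly (p (s n)) y \<noteq> b" if "y \<in> ball z \<rho>" for n y
        proof -
          have "y \<notin> K (\<omega> (s n))"
            using dich[of "s n"] s(2)[of n] that by blast
          then show ?thesis
            using K v_in_K[OF \<sigma>] b(1) by metis
        qed
      qed (auto intro: holomorphic_intros)
      then show ?thesis
        using normal_sequence_on_subseq[OF s(1), of _ "\<lambda>n. poly (p n)"] by simp
    qed
  qed
  moreover have "openin riemann_sphere (Some ` ball z (\<rho> / 2))"
    by (simp add: riemann_sphere_def)
  moreover have "Some z \<in> Some ` ball z (\<rho> / 2)"
    using \<rho>(1) by simp
  ultimately have "Some z \<in> fatou_set (sphere_poly ` word_polys)"
    unfolding fatou_set_def by blast
  then show False
    using assms by (simp add: julia_set_def)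
qed

theorem connected_julia: "connectedin riemann_sphere (julia_set (sphere_poly ` word_polys))"
proof -
  define S where "S = {z. Some z \<in> julia_set (sphere_poly ` word_polys)}"
  have "Q \<subseteq> S"
    using J_subset_julia by (auto simp: Q_def S_def)
  moreover have "S \<subseteq> closure Q"
    using julia_subset_closure_Q by (auto simp: S_def)
  ultimately have "connected S"
    by (rule connected_intermediate_closure[OF connected_Q])
  then have "connectedin riemann_sphere (Some ` S)"
    unfolding riemann_sphere_def by (intro connectedin_continuous_map_image[OF continuous_map_Some]) simp
  moreover have "julia_set (sphere_poly ` word_polys) = Some ` S"
  proof (intro equalityI subsetI)
    fix x assume x: "x \<in> julia_set (sphere_poly ` word_polys)"
    then have "x \<noteq> None"
      using infinity_in_fatou by (metis DiffD2 julia_set_def)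
    then show "x \<in> Some ` S"
      using x by (auto simp: S_def)
  qed (auto simp: S_def)
  ultimately show ?thesis by simp
qed

end

section \<open>The semigroup\<close>

text \<open>Write p = a + z q with q nonconstant. Far out |q| \<ge> 3, and one of the three
  multiples of |z| absorbs a.\<close>

lemma poly_doubles_far_out:
  fixes p :: "complex poly"
  assumes "degree p \<ge> 2"
  shows "\<exists>r. \<forall>z. r \<le> cmod z \<longrightarrow> 2 * cmod z \<le> cmod (poly p z)"
proof -
  obtain a q where p: "p = pCons a q"
    by (cases p)
  obtain b q' where q: "q = pCons b q'"
    by (cases q)
  have "q' \<noteq> 0"
    using assms by (auto simp: p q split: if_splits)
  then obtain r where r: "\<And>z. r \<le> cmod z \<Longrightarrow> 3 \<le> cmod (poly q z)"
    using poly_infinity[of q' 3 b] q by blast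
  have "2 * cmod z \<le> cmod (poly p z)" if z: "max r (cmod a) \<le> cmod z" for z
  proof -
    have "cmod z * 3 \<le> cmod z * cmod (poly q z)"
      using z by (intro mult_left_mono r) auto
    also have "\<dots> = cmod (poly p z - a)"
      by (simp add: p norm_mult)
    also have "\<dots> \<le> cmod (poly p z) + cmod a"
      by (rule norm_triangle_ineq4)
    finally show ?thesis
      using z by simp
  qed
  then show ?thesis by blast
qed

lemma sphere_poly_pcompose: "sphere_poly (p \<circ>\<^sub>p q) = sphere_poly p \<circ> sphere_poly q"
proof
  fix x
  show "sphere_poly (p \<circ>\<^sub>p q) x = (sphere_poly p \<circ> sphere_poly q) x"
    by (cases x) (simp_all add: sphere_poly_def poly_pcompose)
qed

text \<open>Membership in the class only yields some polynomial of degree at least 2 for each map;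
  injectivity identifies it with the given generator.\<close>

lemma sphere_poly_inject:
  assumes "sphere_poly p = sphere_poly q"
  shows "p = q"
proof -
  have "poly p z = poly q z" for z
    using fun_cong[OF assms, of "Some z"] by (simp add: sphere_poly_def)
  then show ?thesis
    using poly_eq_poly_eq_iff[of p q] by (simp add: fun_eq_iff)
qed

lemma generated_semigroup_eq_words:
  "generated_semigroup ((\<lambda>j. sphere_poly (h j)) ` I) = {sphere_poly (word_poly h w) |w. w \<noteq> [] \<and> set w \<subseteq> I}"
proof (intro equalityI subsetI)
  fix g assume "g \<in> generated_semigroup ((\<lambda>j. sphere_poly (h j)) ` I)"
  then show "g \<in> {sphere_poly (word_poly h w) |w. w \<noteq> [] \<and> set w \<subseteq> I}"
  proof induction
    case (generator g)
    then obtain j where "j \<in> I" "g = sphere_poly (h j)"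
      by blast
    then show ?case
      by (intro CollectI exI[of _ "[j]"]) (simp add: pcompose_pCons)
  next
    case (compose f g)
    then obtain u w where "f = sphere_poly (word_poly h u)" "u \<noteq> []" "set u \<subseteq> I"
        "g = sphere_poly (word_poly h w)" "set w \<subseteq> I"
      by blast
    \<comment> \<open>Letters act from left to right, so the word of the inner map g comes
      first.\<close>
    then show ?case
      by (intro CollectI exI[of _ "w @ u"]) (simp add: word_poly_append sphere_poly_pcompose)
  qed
next
  have "sphere_poly (word_poly h w) \<in> generated_semigroup ((\<lambda>j. sphere_poly (h j)) ` I)"
    if "w \<noteq> []" "set w \<subseteq> I" for w
    using that
  proof (induction w rule: list_nonempty_induct)
    case (single j)
    then show ?case
      by (intro generated_semigroup.generator) (simp add: pcompose_pCons)
  next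
    case (cons j w)
    then have "sphere_poly (word_poly h w) \<circ> sphere_poly (h j) \<in> generated_semigroup ((\<lambda>j. sphere_poly (h j)) ` I)"
      by (intro generated_semigroup.compose[OF _ generated_semigroup.generator]) auto
    then show ?case
      by (simp only: sphere_poly_pcompose word_poly.simps)
  qed
  then show "g \<in> generated_semigroup ((\<lambda>j. sphere_poly (h j)) ` I)"
    if "g \<in> {sphere_poly (word_poly h w) |w. w \<noteq> [] \<and> set w \<subseteq> I}" for g
    using that by blast
qed

lemma critical_value_in_planar_postcritical_set:
  assumes "sphere_poly p \<in> G" "poly (pderiv p) z = 0"
  shows "poly p z \<in> planar_postcritical_set G"
proof -
  have "Some (poly p z) \<in> critical_values (sphere_poly p)"
    using assms(2) critical_point_sphere_poly[of p z]
    by (auto simp: critical_values_def sphere_poly_def intro!: exI[of _ "Some z"])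
  then have "Some (poly p z) \<in> (\<Union>g\<in>G. critical_values g)"
    using assms(1) by blast
  moreover have "topspace riemann_sphere = UNIV"
    by (simp add: riemann_sphere_def UNIV_option_conv)
  ultimately show ?thesis
    unfolding planar_postcritical_set_def postcritical_set_def
    using closure_of_subset[of "\<Union>g\<in>G. critical_values g" riemann_sphere] by auto
qed

text \<open>The number in \<open>fix_pt\<close> is the fixed point of \<open>Psi p\<close>, the log
  capacity of the Julia set of p. The slope is at least 2, so points move away from it and none
  outside the interval is mapped into it.\<close>

lemma Psi_reflects_interval:
  assumes deg: "degree p \<ge> 2"
    and fix_pt: "(- 1) / (real (degree p) - 1) * ln (cmod (lead_coeff p)) \<in> {\<alpha>..\<beta>}"
    and x: "Psi p x \<in> {\<alpha>..\<beta>}"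
  shows "x \<in> {\<alpha>..\<beta>}"
proof -
  define d a where "d = real (degree p)" and "a = ln (cmod (lead_coeff p))"
  define c where "c = (- 1) / (d - 1) * a"
  have d: "d \<ge> 2"
    using deg by (simp add: d_def)
  then have c: "Psi p x = x + (d - 1) * (x - c)"
    by (simp add: Psi_def c_def d_def[symmetric] a_def[symmetric] field_simps)
  have "c \<in> {\<alpha>..\<beta>}"
    using fix_pt by (simp add: c_def d_def a_def)
  moreover have "x \<le> Psi p x" if "c \<le> x"
    using that d by (simp add: c)
  moreover have "Psi p x \<le> x" if "x \<le> c"
    using that d by (simp add: c mult_nonneg_nonpos)
  ultimately show ?thesis
    using x by (cases "c \<le> x") auto
qed

theorem theorem2p14:
  fixes m :: nat and h :: "nat \<Rightarrow> complex poly"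
    and G :: "(complex option \<Rightarrow> complex option) set" and \<alpha> \<beta> :: real
  assumes "m \<ge> 1"
    and "\<And>j. j \<in> {1..m} \<Longrightarrow> degree (h j) \<ge> 1"
    and "G = generated_semigroup ((\<lambda>j. sphere_poly (h j)) ` {1..m})"
    and "G \<in> postcritically_bounded_semigroups"
    and "\<alpha> = Min ((\<lambda>j. (- 1) / (real (degree (h j)) - 1) * ln (cmod (lead_coeff (h j)))) ` {1..m})"
    and "\<beta> = Max ((\<lambda>j. (- 1) / (real (degree (h j)) - 1) * ln (cmod (lead_coeff (h j)))) ` {1..m})"
    and "{\<alpha>..\<beta>} \<subseteq> (\<Union>j\<in>{1..m}. Psi (h j) -` {\<alpha>..\<beta>})"
  shows "connectedin riemann_sphere (julia_set G)"
proof -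
  let ?I = "{1..m}"
  let ?c = "\<lambda>j. (- 1) / (real (degree (h j)) - 1) * ln (cmod (lead_coeff (h j)))"
  have G: "G = {sphere_poly (word_poly h w) |w. w \<noteq> [] \<and> set w \<subseteq> ?I}"
    unfolding assms(3) by (rule generated_semigroup_eq_words)
  have deg: "degree (h j) \<ge> 2" if "j \<in> ?I" for j
  proof -
    have "sphere_poly (h j) \<in> G"
      unfolding assms(3) using that by (intro generated_semigroup.generator) auto
    then obtain p where "degree p \<ge> 2" "sphere_poly (h j) = sphere_poly p"
      using assms(4) unfolding postcritically_bounded_semigroups_def by blast
    then show ?thesis
      using sphere_poly_inject by blast
  qed
  have "bounded (planar_postcritical_set G)"
    using assms(4) by (simp add: postcritically_bounded_semigroups_def)
  then obtain R0 where R0: "\<And>z. z \<in> planar_postcritical_set G \<Longrightarrow> cmod z \<le> R0"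
    by (auto simp: bounded_iff)
  have "\<forall>j. \<exists>r. j \<in> ?I \<longrightarrow> (\<forall>z. r \<le> cmod z \<longrightarrow> 2 * cmod z \<le> cmod (poly (h j) z))"
    using poly_doubles_far_out deg by blast
  then obtain \<rho> where \<rho>: "\<And>j z. j \<in> ?I \<Longrightarrow> \<rho> j \<le> cmod z \<Longrightarrow> 2 * cmod z \<le> cmod (poly (h j) z)"
    by metis
  \<comment> \<open>The three entries give \<beta> \<le> ln R, the strict bound on critical values,
    and escape for all generators.\<close>
  define R where "R = Max (insert (exp \<beta>) (insert (R0 + 1) (\<rho> ` ?I)))"
  have R: "exp \<beta> \<le> R" "R0 + 1 \<le> R" "\<And>j. j \<in> ?I \<Longrightarrow> \<rho> j \<le> R"
    unfolding R_def by (intro Max_ge; simp)+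
  then have "R > 0"
    using exp_gt_zero[of \<beta>] by linarith
  have crit: "cmod (poly (word_poly h w) z) < R"
    if w: "set w \<subseteq> ?I" and z: "poly (pderiv (word_poly h w)) z = 0" for w z
  proof -
    \<comment> \<open>The empty word is the identity, whose derivative is 1.\<close>
    have "w \<noteq> []"
      using z by (auto simp: pderiv_pCons)
    then have "sphere_poly (word_poly h w) \<in> G"
      unfolding G using w by blast
    then have "cmod (poly (word_poly h w) z) \<le> R0"
      using z by (intro R0 critical_value_in_planar_postcritical_set)
    then show ?thesis
      using R(2) by simp
  qed
  have one: "1 \<in> ?I"
    using assms(1) by simp
  then have "degree (pderiv (h 1)) \<ge> 1"
    using deg[of 1] by (simp add: degree_pderiv)
  then obtain z0 where z0: "poly (pderiv (h 1)) z0 = 0"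
    using fundamental_theorem_of_algebra[of "pderiv (h 1)"] constant_degree[of "pderiv (h 1)"] by auto
  have c: "?c j \<in> {\<alpha>..\<beta>}" if "j \<in> ?I" for j
    unfolding assms(5,6) atLeastAtMost_iff using that by (intro conjI Min_le Max_ge) auto
  interpret word_system ?I h R "poly (h 1) z0" \<alpha> \<beta>
  proof
    show "2 * cmod z \<le> cmod (poly (h j) z)" if "j \<in> ?I" "R \<le> cmod z" for j z
      using that R(3)[of j] by (intro \<rho>) auto
    \<comment> \<open>By the chain rule z0 is a critical point of the word \<open>1 # w\<close>, so
      this is one of its critical values.\<close>
    show "cmod (poly (word_poly h w) (poly (h 1) z0)) \<le> R" if "set w \<subseteq> ?I" for w
      using crit[of "1 # w" z0] that one z0 by (simp add: poly_pcompose pderiv_pcompose)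
    show "\<alpha> \<le> \<beta>"
      using c[OF one] by simp
    show "\<beta> \<le> ln R"
      using R(1) \<open>R > 0\<close> by (simp add: ln_ge_iff)
    show "x \<in> {\<alpha>..\<beta>}" if "j \<in> ?I" "Psi (h j) x \<in> {\<alpha>..\<beta>}" for j x
      using that deg c by (intro Psi_reflects_interval[of "h j" \<alpha> \<beta> x])
    show "\<exists>j\<in>?I. Psi (h j) x \<in> {\<alpha>..\<beta>}" if "x \<in> {\<alpha>..\<beta>}" for x
      using assms(7) that by blast
  qed (use deg crit \<open>R > 0\<close> assms(1) in auto)
  have "G = sphere_poly ` word_polys"
    unfolding G word_polys_def by blast
  then show ?thesis
    using connected_julia by simp
qed

end
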